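(* Let $p,q$ be primes such that $q$ divides $(p^p-1)/(p-1)$, and let $B$ be the skew brace of order $p^pq$ corresponding to the regular subgroup $G=\langle X,Y_{e_{p-1}},Z\rangle$ of $\mathrm{Hol}(N)$ defined in the context. Then $B$ is not isomorphic (as a skew brace) to its opposite skew brace $B^{\mathrm{op}}$.
   Context: Skew braces: a skew brace $(B,\cdot,\circ)$ is a set with two group operations satisfying $a\circ(b\cdot c)=(a\circ b)\cdot a^{-1}\cdot(a\circ c)$, with $a^{-1}$ the inverse in $(B,\cdot)$. Isomorphisms are bijections respecting both operations. The opposite skew brace $B^{\mathrm{op}}$ is $(B,\cdot^{\mathrm{op}},\circ)$ with $a\cdot^{\mathrm{op}}b=b\cdot a$. Holomorph: for a group $N$, $\mathrm{Hol}(N)=N\rtimes\mathrm{Aut}(N)$ acts on the set $N$ by $(\eta,\alpha)\mu=\eta\alpha(\mu)$, with multiplication $(\eta,\alpha)(\mu,\beta)=(\eta\alpha(\mu),\alpha\beta)$. A subgroup $G$ is regular if for all $\eta,\mu\in N$ there is a unique $g\in G$ with $g\eta=\mu$. A regular $G$ contains, for each $\eta\in N$, a unique element $g_\eta$ with first component $\eta$, and gives the skew brace $(N,\cdot,\circ)$ where $\circ$ is defined by $g_{\eta\circ\eta'}=g_\eta g_{\eta'}$. Notation: $V=\mathbb{F}_p^p$ (column vectors) with standard basis $e_1,\dots,e_p$. $J\in\mathrm{GL}_p(\mathbb{F}_p)$ is the Jordan matrix with $Je_1=e_1$ and $Je_i=e_i+e_{i-1}$ for $2\le i\le p$. $M\in\mathrm{GL}_p(\mathbb{F}_p)$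 is a fixed matrix of order $q$ with $JMJ^{-1}=M^p$ (such an $M$ exists). $N$ is the group, of order $p^pq$, of block matrices $\begin{pmatrix}M^k&v\\0&1\end{pmatrix}\in\mathrm{GL}_{p+1}(\mathbb{F}_p)$ with $0\le k\le q-1$, $v\in V$. If $A\in\mathrm{GL}_p(\mathbb{F}_p)$ normalises $\langle M\rangle$ and $w\in V$, then conjugation by $S=\begin{pmatrix}A&w\\0&1\end{pmatrix}$ is an automorphism $\mathrm{conj}(S)$ of $N$. Elements of $\mathrm{Hol}(N)$ are written $[R,\mathrm{conj}(S)]$ with $R\in N$. Define $$X=\left[\begin{pmatrix}M&0\\0&1\end{pmatrix},\mathrm{conj}\begin{pmatrix}I&0\\0&1\end{pmatrix}\right],\quad Y_v=\left[\begin{pmatrix}I&v\\0&1\end{pmatrix},\mathrm{conj}\begin{pmatrix}I&-v\\0&1\end{pmatrix}\right]\ (v\in V),$$ $$Z=\left[\begin{pmatrix}I&e_p\\0&1\end{pmatrix},\mathrm{conj}\begin{pmatrix}J&-e_p\\0&1\end{pmatrix}\right],$$ and $G=\langle X,Y_{e_{p-1}},Z\rangle\le\mathrm{Hol}(N)$, which is a regular subgroup of $\mathrm{Hol}(N)$. The resulting skew brace $B$ is simple. *)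

theory Defs
  imports
    "HOL-Algebra.Algebra"
    "Jordan_Normal_Form.Jordan_Normal_Form"
    "Berlekamp_Zassenhaus.Finite_Field"
begin

section \<open>Skew braces\<close>

text \<open>A skew brace is stored as its two groups, so that \<^const>\<open>hom\<close>, \<^const>\<open>iso\<close> and
  \<^const>\<open>m_inv\<close> apply to each of them.\<close>

record 'a skew_brace =
  dot_group :: "'a monoid"
  circ_group :: "'a monoid"

definition is_skew_brace :: "'a skew_brace \<Rightarrow> bool" where
  "is_skew_brace B \<longleftrightarrow>
     group (dot_group B) \<and> group (circ_group B) \<and>
     carrier (circ_group B) = carrier (dot_group B) \<and>
     (\<forall>a \<in> carrier (dot_group B). \<forall>b \<in> carrier (dot_group B). \<forall>c \<in> carrier (dot_group B).
        a \<otimes>\<^bsub>circ_group B\<^esub> (b \<otimes>\<^bsub>dot_group B\<^esub> c) =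
        (a \<otimes>\<^bsub>circ_group B\<^esub> b) \<otimes>\<^bsub>dot_group B\<^esub> inv\<^bsub>dot_group B\<^esub> a
          \<otimes>\<^bsub>dot_group B\<^esub> (a \<otimes>\<^bsub>circ_group B\<^esub> c))"

definition skew_brace_isomorphic :: "'a skew_brace \<Rightarrow> 'b skew_brace \<Rightarrow> bool" where
  "skew_brace_isomorphic B C \<longleftrightarrow>
     (\<exists>f. f \<in> iso (dot_group B) (dot_group C) \<and> f \<in> iso (circ_group B) (circ_group C))"

definition op_group :: "'a monoid \<Rightarrow> 'a monoid" where
  "op_group A = A\<lparr>monoid.mult := \<lambda>a b. b \<otimes>\<^bsub>A\<^esub> a\<rparr>"

definition op_skew_brace :: "'a skew_brace \<Rightarrow> 'a skew_brace" where
  "op_skew_brace B = B\<lparr>dot_group := op_group (dot_group B)\<rparr>"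

section \<open>The holomorph and its regular subgroups\<close>

definition Hol :: "'a monoid \<Rightarrow> ('a \<times> ('a \<Rightarrow> 'a)) monoid" where
  "Hol N =
     \<lparr>carrier = carrier N \<times> carrier (AutoGroup N),
      monoid.mult = \<lambda>(\<eta>, \<alpha>) (\<mu>, \<beta>). (\<eta> \<otimes>\<^bsub>N\<^esub> \<alpha> \<mu>, \<alpha> \<otimes>\<^bsub>AutoGroup N\<^esub> \<beta>),
      one = (\<one>\<^bsub>N\<^esub>, \<one>\<^bsub>AutoGroup N\<^esub>)\<rparr>"

definition Hol_act :: "'a monoid \<Rightarrow> 'a \<times> ('a \<Rightarrow> 'a) \<Rightarrow> 'a \<Rightarrow> 'a" where
  "Hol_act N = (\<lambda>(\<eta>, \<alpha>) \<mu>. \<eta> \<otimes>\<^bsub>N\<^esub> \<alpha> \<mu>)"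

definition regular_subgroup :: "'a monoid \<Rightarrow> ('a \<times> ('a \<Rightarrow> 'a)) set \<Rightarrow> bool" where
  "regular_subgroup N G \<longleftrightarrow> subgroup G (Hol N) \<and>
     (\<forall>\<eta> \<in> carrier N. \<forall>\<mu> \<in> carrier N. \<exists>!g. g \<in> G \<and> Hol_act N g \<eta> = \<mu>)"

definition element_over :: "('a \<times> ('a \<Rightarrow> 'a)) set \<Rightarrow> 'a \<Rightarrow> 'a \<times> ('a \<Rightarrow> 'a)" where
  "element_over G \<eta> = (THE g. g \<in> G \<and> fst g = \<eta>)"

text \<open>The relation \<open>g\<^bsub>\<eta> \<circ> \<eta>'\<^esub> = g\<^bsub>\<eta>\<^esub> g\<^bsub>\<eta>'\<^esub>\<close> is read off on first components.\<close>

definition skew_brace_of :: "'a monoid \<Rightarrow> ('a \<times> ('a \<Rightarrow> 'a)) set \<Rightarrow> 'a skew_brace" where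
  "skew_brace_of N G =
     \<lparr>dot_group = N,
      circ_group =
        \<lparr>carrier = carrier N,
         monoid.mult = \<lambda>\<eta> \<eta>'. fst (element_over G \<eta> \<otimes>\<^bsub>Hol N\<^esub> element_over G \<eta>'),
         one = \<one>\<^bsub>N\<^esub>\<rparr>\<rparr>"

context
  fixes N :: "'a monoid" and G :: "('a \<times> ('a \<Rightarrow> 'a)) set"
  assumes N: "group N" and G: "regular_subgroup N G"
begin

lemma regular_subgroup_memD:
  assumes "(\<eta>, \<alpha>) \<in> G"
  shows "\<eta> \<in> carrier N" "\<alpha> \<in> auto N" "\<alpha> \<in> hom N N"
  using assms G subgroup.subset[of G "Hol N"]
  by (auto simp: regular_subgroup_def Hol_def AutoGroup_def auto_def)

lemma element_over:
  assumes "\<eta> \<in> carrier N"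
  shows "element_over G \<eta> \<in> G" "fst (element_over G \<eta>) = \<eta>"
    and "\<And>g. g \<in> G \<Longrightarrow> fst g = \<eta> \<Longrightarrow> g = element_over G \<eta>"
proof -
  interpret N: group N by (rule N)
  have act: "Hol_act N g \<one>\<^bsub>N\<^esub> = fst g" if "g \<in> G" for g
  proof (cases g)
    case (Pair \<eta> \<alpha>)
    then show ?thesis
      using that regular_subgroup_memD[of \<eta> \<alpha>] by (simp add: Hol_act_def Group.hom_one[OF _ N N])
  qed
  have "\<exists>!g. g \<in> G \<and> Hol_act N g \<one>\<^bsub>N\<^esub> = \<eta>"
    using G assms by (simp add: regular_subgroup_def)
  then have ex1: "\<exists>!g. g \<in> G \<and> fst g = \<eta>"
    using act by metis
  show "element_over G \<eta> \<in> G" "fst (element_over G \<eta>) = \<eta>"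
    using theI'[OF ex1] by (simp_all add: element_over_def)
  then show "\<And>g. g \<in> G \<Longrightarrow> fst g = \<eta> \<Longrightarrow> g = element_over G \<eta>"
    using ex1 by blast
qed

lemma element_over_circ:
  assumes "\<eta> \<in> carrier N" "\<eta>' \<in> carrier N"
  shows "\<eta> \<otimes>\<^bsub>circ_group (skew_brace_of N G)\<^esub> \<eta>' = \<eta> \<otimes>\<^bsub>N\<^esub> snd (element_over G \<eta>) \<eta>'"
    and "\<eta> \<otimes>\<^bsub>circ_group (skew_brace_of N G)\<^esub> \<eta>' \<in> carrier N"
    and "element_over G (\<eta> \<otimes>\<^bsub>circ_group (skew_brace_of N G)\<^esub> \<eta>') =
      element_over G \<eta> \<otimes>\<^bsub>Hol N\<^esub> element_over G \<eta>'"
proof -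
  interpret N: group N by (rule N)
  obtain \<alpha> \<beta> where ab: "element_over G \<eta> = (\<eta>, \<alpha>)" "element_over G \<eta>' = (\<eta>', \<beta>)"
    using element_over(2)[OF assms(1)] element_over(2)[OF assms(2)] by (metis prod.collapse)
  have "(\<eta>, \<alpha>) \<in> G" "(\<eta>', \<beta>) \<in> G"
    using element_over(1)[OF assms(1)] element_over(1)[OF assms(2)] ab by simp_all
  then have prod: "(\<eta>, \<alpha>) \<otimes>\<^bsub>Hol N\<^esub> (\<eta>', \<beta>) \<in> G"
    using G subgroup.m_closed by (fastforce simp: regular_subgroup_def)
  show 1: "\<eta> \<otimes>\<^bsub>circ_group (skew_brace_of N G)\<^esub> \<eta>' = \<eta> \<otimes>\<^bsub>N\<^esub> snd (element_over G \<eta>) \<eta>'"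
    using ab by (simp add: skew_brace_of_def Hol_def)
  have "\<alpha> \<in> hom N N"
    using \<open>(\<eta>, \<alpha>) \<in> G\<close> regular_subgroup_memD by blast
  then show 2: "\<eta> \<otimes>\<^bsub>circ_group (skew_brace_of N G)\<^esub> \<eta>' \<in> carrier N"
    using assms by (simp add: 1 ab hom_in_carrier)
  show "element_over G (\<eta> \<otimes>\<^bsub>circ_group (skew_brace_of N G)\<^esub> \<eta>') =
      element_over G \<eta> \<otimes>\<^bsub>Hol N\<^esub> element_over G \<eta>'"
    using element_over(3)[OF 2 prod] 1 ab by (simp add: Hol_def)
qed

lemma group_Hol: "group (Hol N)"
proof -
  interpret N: group N by (rule N)
  interpret A: group "AutoGroup N" by (rule N.AutoGroup)
  have A: "\<And>\<alpha>. \<alpha> \<in> carrier (AutoGroup N) \<Longrightarrow> \<alpha> \<in> hom N N"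
    by (auto simp: AutoGroup_def auto_def)
  have mult: "(\<alpha> \<otimes>\<^bsub>AutoGroup N\<^esub> \<beta>) x = \<alpha> (\<beta> x)"
    if "\<alpha> \<in> carrier (AutoGroup N)" "\<beta> \<in> carrier (AutoGroup N)" "x \<in> carrier N" for \<alpha> \<beta> x
    using that by (simp add: AutoGroup_def BijGroup_def auto_def compose_def)
  have one: "\<one>\<^bsub>AutoGroup N\<^esub> x = x" if "x \<in> carrier N" for x
    using that by (simp add: AutoGroup_def BijGroup_def)
  show ?thesis
  proof (rule groupI)
    fix x assume "x \<in> carrier (Hol N)"
    then obtain \<eta> \<alpha> where x: "x = (\<eta>, \<alpha>)" "\<eta> \<in> carrier N" "\<alpha> \<in> carrier (AutoGroup N)"
      by (auto simp: Hol_def)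
    let ?b = "inv\<^bsub>AutoGroup N\<^esub> \<alpha>"
    have b: "?b \<in> carrier (AutoGroup N)" using x by simp
    have c: "?b (inv\<^bsub>N\<^esub> \<eta>) \<in> carrier N" using x A[OF b] by (simp add: hom_in_carrier)
    have "?b (inv\<^bsub>N\<^esub> \<eta>) \<otimes>\<^bsub>N\<^esub> ?b \<eta> = ?b (inv\<^bsub>N\<^esub> \<eta> \<otimes>\<^bsub>N\<^esub> \<eta>)"
      using x by (simp add: Group.hom_mult[OF A[OF b], symmetric])
    also have "\<dots> = \<one>\<^bsub>N\<^esub>"
      using x Group.hom_one[OF A[OF b] N N] by simp
    finally have "?b (inv\<^bsub>N\<^esub> \<eta>) \<otimes>\<^bsub>N\<^esub> ?b \<eta> = \<one>\<^bsub>N\<^esub>" .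
    then show "\<exists>y\<in>carrier (Hol N). y \<otimes>\<^bsub>Hol N\<^esub> x = \<one>\<^bsub>Hol N\<^esub>"
      using x b c by (intro bexI[of _ "(?b (inv\<^bsub>N\<^esub> \<eta>), ?b)"]) (auto simp: Hol_def)
  qed (auto simp: Hol_def hom_in_carrier[OF A] Group.hom_mult[OF A] mult one N.m_assoc A.m_assoc)
qed

lemma is_skew_brace_skew_brace_of: "is_skew_brace (skew_brace_of N G)"
proof -
  interpret N: group N by (rule N)
  interpret H: group "Hol N" by (rule group_Hol)
  have G': "subgroup G (Hol N)" using G by (simp add: regular_subgroup_def)
  let ?C = "circ_group (skew_brace_of N G)"
  have car: "carrier ?C = carrier N" "\<one>\<^bsub>?C\<^esub> = \<one>\<^bsub>N\<^esub>" by (simp_all add: skew_brace_of_def)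
  have inj: "\<eta> = \<eta>'"
    if "\<eta> \<in> carrier N" "\<eta>' \<in> carrier N" "element_over G \<eta> = element_over G \<eta>'" for \<eta> \<eta>'
    using that element_over(2) by metis
  have H: "element_over G \<eta> \<in> carrier (Hol N)" if "\<eta> \<in> carrier N" for \<eta>
    by (rule subgroup.mem_carrier[OF G' element_over(1)[OF that]])
  have one: "element_over G \<one>\<^bsub>N\<^esub> = \<one>\<^bsub>Hol N\<^esub>"
    by (rule element_over(3)[OF N.one_closed subgroup.one_closed[OF G'], symmetric])
      (simp add: Hol_def)
  have "group ?C"
  proof (rule groupI)
    fix x assume "x \<in> carrier ?C"
    then have x: "x \<in> carrier N" by (simp add: car)
    let ?g = "inv\<^bsub>Hol N\<^esub> (element_over G x)"
    have g: "?g \<in> G" by (rule subgroup.m_inv_closed[OF G' element_over(1)[OF x]])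
    then have y: "fst ?g \<in> carrier N"
      using regular_subgroup_memD(1)[of "fst ?g" "snd ?g"] by simp
    have "element_over G (fst ?g) = ?g"
      using element_over(3)[OF y g] by simp
    then have "element_over G (fst ?g \<otimes>\<^bsub>?C\<^esub> x) = element_over G \<one>\<^bsub>N\<^esub>"
      using element_over_circ(3)[OF y x] H.l_inv[OF H[OF x]] by (simp add: one)
    then have "fst ?g \<otimes>\<^bsub>?C\<^esub> x = \<one>\<^bsub>?C\<^esub>"
      using inj element_over_circ(2)[OF y x] by (simp add: car)
    then show "\<exists>y\<in>carrier ?C. y \<otimes>\<^bsub>?C\<^esub> x = \<one>\<^bsub>?C\<^esub>" using y car by auto
  next
    fix x y z assume "x \<in> carrier ?C" "y \<in> carrier ?C" "z \<in> carrier ?C"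
    then have c: "x \<in> carrier N" "y \<in> carrier N" "z \<in> carrier N" by (simp_all add: car)
    show "x \<otimes>\<^bsub>?C\<^esub> y \<otimes>\<^bsub>?C\<^esub> z = x \<otimes>\<^bsub>?C\<^esub> (y \<otimes>\<^bsub>?C\<^esub> z)"
      by (rule inj) (simp_all add: c element_over_circ(2,3) H H.m_assoc)
  next
    fix x assume "x \<in> carrier ?C"
    then have c: "x \<in> carrier N" by (simp add: car)
    show "\<one>\<^bsub>?C\<^esub> \<otimes>\<^bsub>?C\<^esub> x = x"
      unfolding car by (rule inj) (simp_all add: c element_over_circ(2,3) H one)
  qed (simp_all add: car element_over_circ(2))
  moreover have "a \<otimes>\<^bsub>?C\<^esub> (b \<otimes>\<^bsub>N\<^esub> c) = (a \<otimes>\<^bsub>?C\<^esub> b) \<otimes>\<^bsub>N\<^esub> inv\<^bsub>N\<^esub> a \<otimes>\<^bsub>N\<^esub> (a \<otimes>\<^bsub>?C\<^esub> c)"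
    if c: "a \<in> carrier N" "b \<in> carrier N" "c \<in> carrier N" for a b c
  proof -
    let ?al = "snd (element_over G a)"
    have hom: "?al \<in> hom N N"
      using element_over(1)[OF c(1)] regular_subgroup_memD(3) by (metis prod.collapse)
    have cl: "?al b \<in> carrier N" "?al c \<in> carrier N" using hom c by (simp_all add: hom_in_carrier)
    have "inv\<^bsub>N\<^esub> a \<otimes>\<^bsub>N\<^esub> (a \<otimes>\<^bsub>N\<^esub> ?al c) = ?al c"
      using c cl by (simp add: N.m_assoc[symmetric])
    then show ?thesis
      using c cl hom by (simp add: element_over_circ(1) Group.hom_mult N.m_assoc)
  qed
  ultimately show ?thesis
    using N car by (simp add: is_skew_brace_def skew_brace_of_def)
qed

end

section \<open>The group \<open>N\<close> and the subgroup \<open>G\<close> of its holomorph\<close>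

abbreviation GL :: "nat \<Rightarrow> 'a :: field mat monoid" where
  "GL n \<equiv> units_of (ring_mat TYPE('a) n ())"

definition block :: "'a :: field mat \<Rightarrow> 'a vec \<Rightarrow> 'a mat" where
  "block A v = four_block_mat A (mat_of_cols (dim_vec v) [v]) (0\<^sub>m 1 (dim_col A)) (1\<^sub>m 1)"

definition N_group :: "nat \<Rightarrow> nat \<Rightarrow> 'a :: field mat \<Rightarrow> 'a mat monoid" where
  "N_group p q M =
     GL (p + 1) \<lparr>carrier := {block (M ^\<^sub>m k) v | k v. k < q \<and> v \<in> carrier_vec p}\<rparr>"

text \<open>Automorphisms in \<^const>\<open>AutoGroup\<close> are extensional, hence the restriction.\<close>

definition conj_by :: "nat \<Rightarrow> nat \<Rightarrow> 'a :: field mat \<Rightarrow> 'a mat \<Rightarrow> 'a mat \<Rightarrow> 'a mat" where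
  "conj_by p q M S =
     (\<lambda>R \<in> carrier (N_group p q M). S \<otimes>\<^bsub>GL (p + 1)\<^esub> R \<otimes>\<^bsub>GL (p + 1)\<^esub> inv\<^bsub>GL (p + 1)\<^esub> S)"

text \<open>Indices of vectors start at 0: the basis vector \<open>e\<^sub>i\<close> is \<open>unit_vec p (i - 1)\<close>.\<close>

definition basis_vec :: "nat \<Rightarrow> nat \<Rightarrow> 'a :: field vec" where
  "basis_vec p i = unit_vec p (i - 1)"

definition X_elem :: "nat \<Rightarrow> nat \<Rightarrow> 'a :: field mat \<Rightarrow> 'a mat \<times> ('a mat \<Rightarrow> 'a mat)" where
  "X_elem p q M = (block M (0\<^sub>v p), conj_by p q M (block (1\<^sub>m p) (0\<^sub>v p)))"

definition Y_elem ::
  "nat \<Rightarrow> nat \<Rightarrow> 'a :: field mat \<Rightarrow> 'a vec \<Rightarrow> 'a mat \<times> ('a mat \<Rightarrow> 'a mat)" where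
  "Y_elem p q M v = (block (1\<^sub>m p) v, conj_by p q M (block (1\<^sub>m p) (- v)))"

definition Z_elem :: "nat \<Rightarrow> nat \<Rightarrow> 'a :: field mat \<Rightarrow> 'a mat \<times> ('a mat \<Rightarrow> 'a mat)" where
  "Z_elem p q M =
     (block (1\<^sub>m p) (basis_vec p p),
      conj_by p q M (block (jordan_block p 1) (- basis_vec p p)))"

definition G_subgroup :: "nat \<Rightarrow> nat \<Rightarrow> 'a :: field mat \<Rightarrow> ('a mat \<times> ('a mat \<Rightarrow> 'a mat)) set" where
  "G_subgroup p q M =
     generate (Hol (N_group p q M))
       {X_elem p q M, Y_elem p q M (basis_vec p (p - 1)), Z_elem p q M}"

end

theory Submission
  imports Defs
begin

text \<open>
  Replacing \<open>[\<eta>, conj S]\<close> by the pair \<open>(\<eta> S, S)\<close> of the left and the right factor of its action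
  turns the generators into \<open>X = (M, I)\<close>, \<open>Y\<^sub>v = (I, (I, -v))\<close> and \<open>Z = (J, (J, -e\<^sub>p))\<close>.
  Hence \<open>G\<close> consists of the elements \<open>[(M\<^sup>k, - M\<^sup>k w), conj (J\<^sup>i, w)]\<close> with \<open>w\<close> in \<open>V\<close> arbitrary and
  \<open>i\<close> minus the last coordinate of \<open>w\<close>.  If \<open>v\<close> has last coordinate 0, the translation by \<open>v\<close>
  comes with \<open>conj (I, -v)\<close>, so that \<open>c = (I, v)\<close> satisfies \<open>c \<circ> b = b \<cdot> c\<close> for all \<open>b\<close>.
  An isomorphism from \<open>B\<close> to its opposite sends \<open>c\<close> to an element \<open>a\<close> of order \<open>p\<close>,
  i.e. to a translation by some nonzero \<open>u\<close>, with \<open>a \<circ> b = a \<cdot> b\<close> for all \<open>b\<close>.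
  Testing this on \<open>b = (M, 0)\<close> gives \<open>M u = u\<close>, which is impossible.
\<close>

section \<open>Matrix groups and block matrices\<close>

lemma GL_simps:
  "A \<otimes>\<^bsub>GL n\<^esub> B = A * B" "\<one>\<^bsub>GL n\<^esub> = 1\<^sub>m n"
  by (simp_all add: units_of_def ring_mat_def)

lemma GL_memI:
  assumes "A \<in> carrier_mat n n" "B \<in> carrier_mat n n" "A * B = 1\<^sub>m n" "B * A = 1\<^sub>m n"
  shows "A \<in> carrier (GL n)"
  using assms by (auto simp: units_of_def Units_def ring_mat_def)

lemma GL_carrier_mat:
  assumes "A \<in> carrier (GL n)"
  shows "A \<in> carrier_mat n n"
  using assms by (auto simp: units_of_def Units_def ring_mat_def)

lemma group_GL: "group (GL n :: 'a :: field mat monoid)"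
proof -
  interpret ring "ring_mat TYPE('a) n ()" by (rule ring_mat)
  show ?thesis by (rule units_group)
qed

lemma GL_pow: "A [^]\<^bsub>GL n\<^esub> (k :: nat) = A ^\<^sub>m k" if "A \<in> carrier (GL n)"
proof -
  interpret group "GL n" by (rule group_GL)
  show ?thesis using GL_carrier_mat[OF that] by (induction k) (simp_all add: GL_simps)
qed

lemma pow_mat_add:
  fixes A :: "'a :: semiring_1 mat"
  assumes "A \<in> carrier_mat n n"
  shows "A ^\<^sub>m (j + k) = A ^\<^sub>m j * A ^\<^sub>m k"
proof (induction k)
  case (Suc k)
  then show ?case using assms by (simp add: assoc_mult_mat[of _ n n _ n _ n])
qed (use assms in simp)

lemma pow_mat_mult:
  fixes A :: "'a :: semiring_1 mat"
  assumes "A \<in> carrier_mat n n"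
  shows "A ^\<^sub>m (j * k) = (A ^\<^sub>m j) ^\<^sub>m k"
proof (induction k)
  case (Suc k)
  have "A ^\<^sub>m (j * Suc k) = A ^\<^sub>m (j * k + j)" by (simp add: algebra_simps)
  then show ?case using Suc by (simp add: pow_mat_add[OF assms])
qed (use assms in simp)

lemma one_pow_mat: "1\<^sub>m n ^\<^sub>m k = (1\<^sub>m n :: 'a :: semiring_1 mat)"
  by (induction k) simp_all

lemma pow_mat_fixed:
  fixes A :: "'a :: semiring_1 mat"
  assumes "A \<in> carrier_mat n n" "v \<in> carrier_vec n" "A *\<^sub>v v = v"
  shows "A ^\<^sub>m k *\<^sub>v v = v"
  using assms by (induction k) (simp_all add: assoc_mult_mat_vec[of _ n n _ n])

lemma block_carrier_mat:
  assumes "A \<in> carrier_mat n n" "v \<in> carrier_vec n"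
  shows "block A v \<in> carrier_mat (n + 1) (n + 1)"
  using assms by (auto simp: block_def)

text \<open>Block matrices multiply like the affine maps sending \<open>x\<close> to
  \<open>A x + v\<close>.\<close>

lemma block_mult:
  assumes "A \<in> carrier_mat n n" "B \<in> carrier_mat n n" "v \<in> carrier_vec n" "w \<in> carrier_vec n"
  shows "block A v * block B w = block (A * B) (A *\<^sub>v w + v)"
proof -
  have [simp]: "dim_vec v = n" "dim_vec w = n" "dim_row A = n" "dim_col A = n" "dim_row B = n" "dim_col B = n"
    using assms by auto
  let ?v = "mat_of_cols n [v]" and ?w = "mat_of_cols n [w]"
  have c: "?v \<in> carrier_mat n 1" "?w \<in> carrier_mat n 1" by (auto intro!: carrier_matI)
  have 1: "A * ?w + ?v = mat_of_cols n [A *\<^sub>v w + v]"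
  proof (rule eq_matI)
    fix i j assume "i < dim_row (mat_of_cols n [A *\<^sub>v w + v])" "j < dim_col (mat_of_cols n [A *\<^sub>v w + v])"
    then have "i < n" "j = 0" by simp_all
    then show "(A * ?w + ?v) $$ (i, j) = mat_of_cols n [A *\<^sub>v w + v] $$ (i, j)"
      using assms col_mat_of_cols[of 0 "[w]" n] by (simp add: mat_of_cols_index)
  qed simp_all
  have "block A v * block B w = four_block_mat (A * B + ?v * 0\<^sub>m 1 n) (A * ?w + ?v * 1\<^sub>m 1)
      (0\<^sub>m 1 n * B + 1\<^sub>m 1 * 0\<^sub>m 1 n) (0\<^sub>m 1 n * ?w + 1\<^sub>m 1 * 1\<^sub>m 1)"
    unfolding block_def using assms c
    by (subst mult_four_block_mat[of _ n n _ 1 _ 1 _ _ n _ 1]) auto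
  also have "\<dots> = block (A * B) (A *\<^sub>v w + v)"
    using assms c 1 unfolding block_def by simp
  finally show ?thesis .
qed

lemma block_eq_iff:
  assumes "A \<in> carrier_mat n n" "B \<in> carrier_mat n n" "v \<in> carrier_vec n" "w \<in> carrier_vec n"
  shows "block A v = block B w \<longleftrightarrow> A = B \<and> v = w"
proof
  assume eq: "block A v = block B w"
  have e: "block A v $$ (i, j) = (if j < n then A $$ (i, j) else v $ i)" if "i < n" "j < Suc n"
    "A \<in> carrier_mat n n" "v \<in> carrier_vec n" for A :: "'a mat" and v i j
    using that by (auto simp: block_def mat_of_cols_def)
  have "A = B"
  proof (rule eq_matI)
    fix i j assume "i < dim_row B" "j < dim_col B"
    then show "A $$ (i, j) = B $$ (i, j)"
      using arg_cong[OF eq, of "\<lambda>m. m $$ (i, j)"] assms by (simp add: e)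
  qed (use assms in auto)
  moreover have "v = w"
  proof (rule eq_vecI)
    fix i assume "i < dim_vec w"
    then show "v $ i = w $ i"
      using arg_cong[OF eq, of "\<lambda>m. m $$ (i, n)"] assms by (simp add: e)
  qed (use assms in auto)
  ultimately show "A = B \<and> v = w" by simp
qed simp

lemma block_one: "block (1\<^sub>m n) (0\<^sub>v n) = 1\<^sub>m (n + 1)"
  by (rule eq_matI) (auto simp: block_def mat_of_cols_def)

text \<open>Row \<open>i\<close> of the Jordan block has ones only in columns \<open>i\<close> and
  \<open>i + 1\<close>, as far as the latter exists, so each coordinate picks up its
  successor.\<close>

lemma jordan_block_one_mult_vec:
  fixes v :: "'a :: field vec"
  assumes "v \<in> carrier_vec n" "i < n"
  shows "(jordan_block n 1 *\<^sub>v v) $ i = v $ i + (if Suc i < n then v $ Suc i else 0)"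
proof -
  have "(jordan_block n 1 *\<^sub>v v) $ i =
      (\<Sum>j<n. (if j = i then v $ j else 0) + (if j = Suc i then v $ j else 0))"
    using assms by (auto simp: scalar_prod_def atLeast0LessThan intro!: sum.cong)
  also have "\<dots> = v $ i + (if Suc i < n then v $ Suc i else 0)"
    using assms by (simp add: sum.distrib)
  finally show ?thesis .
qed

text \<open>Above the diagonal, the entry at \<open>(i, j)\<close> of this power is the binomial
  coefficient of \<open>CHAR('a)\<close> over \<open>j - i\<close>. The prime divides it because
  \<open>0 < j - i < CHAR('a)\<close>.\<close>

lemma jordan_block_one_pow_prime:
  assumes "Factorial_Ring.prime (CHAR('a :: field))"
  shows "jordan_block (CHAR('a)) (1 :: 'a) ^\<^sub>m CHAR('a) = 1\<^sub>m (CHAR('a))"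
proof (rule eq_matI)
  fix i j assume "i < dim_row (1\<^sub>m CHAR('a) :: 'a mat)" "j < dim_col (1\<^sub>m CHAR('a) :: 'a mat)"
  moreover have "(of_nat (CHAR('a) choose (j - i)) :: 'a) = 0" if "i < j" "j < CHAR('a)"
    using dvd_choose_prime[of "j - i" "CHAR('a)"] that assms by (simp add: of_nat_eq_0_iff_char_dvd)
  ultimately show "(jordan_block (CHAR('a)) (1 :: 'a) ^\<^sub>m CHAR('a)) $$ (i, j) = 1\<^sub>m (CHAR('a)) $$ (i, j)"
    by (auto simp: jordan_block_pow)
qed (simp_all add: jordan_block_pow)

lemma op_group_simps [simp]:
  "x \<otimes>\<^bsub>op_group A\<^esub> y = y \<otimes>\<^bsub>A\<^esub> x" "carrier (op_group A) = carrier A"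
  by (simp_all add: op_group_def)

lemma pow_mat_cong:
  fixes A :: "'a :: semiring_1 mat"
  assumes A: "A \<in> carrier_mat n n" and "A ^\<^sub>m m = 1\<^sub>m n" and "i mod m = j mod m"
  shows "A ^\<^sub>m i = A ^\<^sub>m j"
proof -
  have "A ^\<^sub>m i = A ^\<^sub>m (i mod m)" for i
  proof -
    have "A ^\<^sub>m i = A ^\<^sub>m (m * (i div m) + i mod m)" by simp
    also have "\<dots> = A ^\<^sub>m (i mod m)"
      using assms by (simp only: pow_mat_add[OF A] pow_mat_mult[OF A]) (simp add: one_pow_mat)
    finally show ?thesis .
  qed
  then show ?thesis using assms(3) by metis
qed

lemma mult_mat_vec_uminus:
  fixes A :: "'a :: comm_ring_1 mat"
  assumes "A \<in> carrier_mat m n" "v \<in> carrier_vec n"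
  shows "A *\<^sub>v (- v) = - (A *\<^sub>v v)"
  using assms by (intro eq_vecI) (auto simp: scalar_prod_def sum_negf)

section \<open>The group \<open>N\<close> and its automorphisms\<close>

text \<open>For prime \<open>q\<close>, order \<open>q\<close> amounts to \<open>M^q = 1\<close> and
  \<open>M \<noteq> 1\<close>. The conjugation relation is cleared of its inverse, and the
  divisibility condition appears as \<open>p \<noteq> q\<close>.\<close>

locale brace_data =
  fixes p q :: nat and M :: "'p :: prime_card mod_ring mat"
  assumes card_p: "CARD('p) = p" and prime_q: "Factorial_Ring.prime q" and p_ne_q: "p \<noteq> q"
    and M: "M \<in> carrier_mat p p" and M_pow_q: "M ^\<^sub>m q = 1\<^sub>m p" and M_ne_one: "M \<noteq> 1\<^sub>m p"
    and J_mult_M: "jordan_block p 1 * M = M ^\<^sub>m p * jordan_block p 1"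
begin

text \<open>Otherwise \<open>p + 1\<close> in \<open>GL (p + 1)\<close> would be rewritten to \<open>Suc p\<close>.\<close>

declare One_nat_def [simp del]

abbreviation J :: "'p mod_ring mat" where
  "J \<equiv> jordan_block p 1"

abbreviation V :: "'p mod_ring vec set" where
  "V \<equiv> carrier_vec p"

abbreviation N :: "'p mod_ring mat monoid" where
  "N \<equiv> N_group p q M"

section \<open>Powers of \<open>J\<close> and \<open>M\<close>, and the last coordinate\<close>

lemma prime_p: "Factorial_Ring.prime p"
  using prime_card[where 'a = 'p] card_p by simp

lemma two_le_p: "2 \<le> p"
  using prime_ge_2_nat[OF prime_p] .

lemma q_pos: "0 < q"
  using prime_gt_0_nat[OF prime_q] .

lemma char_p: "CHAR('p mod_ring) = p"
  by (simp add: card_p)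

lemma J_pow_p: "J ^\<^sub>m p = 1\<^sub>m p"
  using jordan_block_one_pow_prime[where 'a = "'p mod_ring"] prime_p by (simp add: card_p)

lemma M_dim [simp]: "dim_row M = p" "dim_col M = p"
  using M by auto

lemma M_pow [simp]: "M ^\<^sub>m k \<in> carrier_mat p p"
  using M by simp

lemma mult_vec_carrier [simp]:
  "w \<in> V \<Longrightarrow> M ^\<^sub>m k *\<^sub>v w \<in> V" "w \<in> V \<Longrightarrow> J ^\<^sub>m i *\<^sub>v w \<in> V"
  by (rule mult_mat_vec_carrier[of _ p p]; simp)+

text \<open>Since \<open>J^p = 1\<close>, an exponent of \<open>J\<close> matters only as an element
  of the prime field.\<close>

lemma J_pow_cong:
  assumes "(of_nat i :: 'p mod_ring) = of_nat j"
  shows "J ^\<^sub>m i = J ^\<^sub>m j"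
  using assms J_pow_p
  by (intro pow_mat_cong[of _ p p]) (simp_all add: of_nat_eq_iff_cong_CHAR cong_def card_p)

lemma M_pow_cong:
  assumes "i mod q = j mod q"
  shows "M ^\<^sub>m i = M ^\<^sub>m j"
  using assms M_pow_q M by (intro pow_mat_cong[of _ p q])

lemma M_pow_dvd:
  assumes "q dvd k"
  shows "M ^\<^sub>m k = 1\<^sub>m p"
  using M_pow_cong[of k 0] assms M by simp

lemma J_mult_M_pow: "J * M ^\<^sub>m k = M ^\<^sub>m (k * p) * J"
proof (induction k)
  case 0
  then show ?case using M by simp
next
  case (Suc k)
  have "J * M ^\<^sub>m Suc k = (J * M ^\<^sub>m k) * M"
    using M by (simp add: assoc_mult_mat[of _ p p _ p _ p])
  also have "\<dots> = M ^\<^sub>m (k * p) * (J * M)"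
    using M by (simp add: Suc assoc_mult_mat[of _ p p _ p _ p])
  also have "\<dots> = M ^\<^sub>m (k * p) * M ^\<^sub>m p * J"
    using M by (simp add: J_mult_M assoc_mult_mat[of _ p p _ p _ p])
  also have "\<dots> = M ^\<^sub>m (Suc k * p) * J"
    by (simp add: pow_mat_add[OF M, symmetric] add.commute)
  finally show ?case .
qed

text \<open>Each factor \<open>J\<close> that moves past \<open>M^k\<close> multiplies the exponent
  \<open>k\<close> by \<open>p\<close>.\<close>

lemma J_pow_mult_M_pow: "J ^\<^sub>m i * M ^\<^sub>m k = M ^\<^sub>m (k * p ^ i) * J ^\<^sub>m i"
proof (induction i arbitrary: k)
  case 0
  then show ?case using M by simp
next
  case (Suc i)
  have "J ^\<^sub>m Suc i * M ^\<^sub>m k = J ^\<^sub>m i * (J * M ^\<^sub>m k)"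
    using M by (simp add: assoc_mult_mat[of _ p p _ p _ p])
  also have "\<dots> = (J ^\<^sub>m i * M ^\<^sub>m (k * p)) * J"
    using M by (simp add: J_mult_M_pow assoc_mult_mat[of _ p p _ p _ p])
  also have "\<dots> = M ^\<^sub>m (k * p * p ^ i) * (J ^\<^sub>m i * J)"
    using M by (simp add: Suc assoc_mult_mat[of _ p p _ p _ p])
  finally show ?case by (simp add: mult.assoc)
qed

text \<open>\<open>J\<close> is upper triangular with unit diagonal. The invariance makes the last
  coordinate additive under the twisted sum \<open>w + J_of w w'\<close> below.\<close>

lemma J_mult_vec_last:
  assumes "w \<in> V"
  shows "(J ^\<^sub>m i *\<^sub>v w) $ (p - 1) = w $ (p - 1)"
proof (induction i)
  case (Suc i)
  \<comment> \<open>\<open>pow_mat\<close> unfolds a factor on the right, while the induction needs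
    it on the left.\<close>
  have "J ^\<^sub>m Suc i = J * J ^\<^sub>m i"
    using pow_mat_add[of J p 1 i] by (simp add: One_nat_def)
  then have "J ^\<^sub>m Suc i *\<^sub>v w = J *\<^sub>v (J ^\<^sub>m i *\<^sub>v w)"
    using assms by (simp add: assoc_mult_mat_vec[of _ p p _ p])
  then show ?case
    using Suc assms two_le_p by (simp add: jordan_block_one_mult_vec del: index_mult_mat_vec)
qed (use assms in simp)

text \<open>The element of \<open>G\<close> over \<open>(M\<^sup>k, v)\<close> acts through \<open>(J\<^sup>i, w)\<close> with \<open>v = - M\<^sup>k w\<close>, and
  the exponent \<open>i\<close> is minus the last coordinate of \<open>w\<close>.\<close>

definition J_exp :: "'p mod_ring vec \<Rightarrow> nat" where
  "J_exp w = (LEAST i. of_nat i = - (w $ (p - 1)))"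

definition J_of :: "'p mod_ring vec \<Rightarrow> 'p mod_ring mat" where
  "J_of w = J ^\<^sub>m J_exp w"

lemma of_nat_J_exp: "of_nat (J_exp w) = - (w $ (p - 1))"
proof -
  have "\<exists>i. of_nat i = - (w $ (p - 1))"
    using surj_of_nat_mod_ring by metis
  then show ?thesis unfolding J_exp_def by (rule LeastI_ex)
qed

lemma J_exp_no_last:
  assumes "w $ (p - 1) = 0"
  shows "J_exp w = 0"
  unfolding J_exp_def using assms by (intro Least_eq_0) simp

lemma J_of_eq:
  assumes "of_nat i = - (w $ (p - 1))"
  shows "J_of w = J ^\<^sub>m i"
  unfolding J_of_def using assms by (intro J_pow_cong) (simp add: of_nat_J_exp)

lemma J_of_carrier [simp]: "J_of w \<in> carrier_mat p p"
  by (simp add: J_of_def)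

lemma J_of_mult_vec_carrier [simp]: "v \<in> V \<Longrightarrow> J_of w *\<^sub>v v \<in> V"
  by (simp add: J_of_def)

text \<open>\<open>J_of w\<close> does not change the last coordinate of \<open>w'\<close>, so the
  last coordinates add up and with them the exponents of \<open>J\<close>.\<close>

lemma J_of_add:
  assumes "w \<in> V" "w' \<in> V"
  shows "J_of (w + J_of w *\<^sub>v w') = J_of w * J_of w'"
proof -
  have "J_of (w + J_of w *\<^sub>v w') = J ^\<^sub>m (J_exp w + J_exp w')"
    using two_le_p assms J_mult_vec_last[OF assms(2), of "J_exp w"]
    by (intro J_of_eq) (simp add: of_nat_J_exp J_of_def del: index_mult_mat_vec)
  then show ?thesis by (simp add: J_of_def pow_mat_add[of J p])
qed

lemma J_of_no_last:
  assumes "w $ (p - 1) = 0"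
  shows "J_of w = 1\<^sub>m p"
  using J_of_eq[of 0 w] assms by simp

section \<open>The conjugating matrices \<open>S w\<close> and their group law\<close>

definition S :: "'p mod_ring vec \<Rightarrow> 'p mod_ring mat" where
  "S w = block (J_of w) w"

text \<open>The vector of the inverse of \<open>S w\<close>: the inverse of an affine map with parts
  \<open>A\<close> and \<open>w\<close> has translation part \<open>- A^(-1) w\<close>. The inverse
  of \<open>J^i\<close> is written as \<open>J^((p - 1) i)\<close> to keep natural
  exponents.\<close>

definition S_neg :: "'p mod_ring vec \<Rightarrow> 'p mod_ring vec" where
  "S_neg w = - (J ^\<^sub>m ((p - 1) * J_exp w) *\<^sub>v w)"

lemma S_neg_carrier [simp]: "w \<in> V \<Longrightarrow> S_neg w \<in> V"
  by (simp add: S_neg_def)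

lemma S_mult:
  assumes "w \<in> V" "w' \<in> V"
  shows "S w * S w' = S (w + J_of w *\<^sub>v w')"
  unfolding S_def J_of_add[OF assms]
  using assms comm_add_vec[of w p "J_of w *\<^sub>v w'"] by (simp add: block_mult[of _ p])

lemma S_zero: "S (0\<^sub>v p) = 1\<^sub>m (p + 1)"
  using two_le_p by (simp add: S_def J_of_no_last block_one)

text \<open>In characteristic \<open>p\<close> the factor \<open>p - 1\<close> is -1, and
  \<open>S_neg\<close> negates the last coordinate.\<close>

lemma J_of_S_neg:
  assumes "w \<in> V"
  shows "J_of (S_neg w) = J ^\<^sub>m ((p - 1) * J_exp w)"
proof (rule J_of_eq)
  have p0: "(of_nat (p - 1) :: 'p mod_ring) = - 1"
    using two_le_p char_p of_nat_CHAR[where 'a = "'p mod_ring"] by (simp add: of_nat_diff)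
  have "S_neg w $ (p - 1) = - ((J ^\<^sub>m ((p - 1) * J_exp w) *\<^sub>v w) $ (p - 1))"
    using two_le_p by (simp add: S_neg_def del: index_mult_mat_vec)
  then have "S_neg w $ (p - 1) = - (w $ (p - 1))"
    by (simp only: J_mult_vec_last[OF assms])
  then show "of_nat ((p - 1) * J_exp w) = - (S_neg w $ (p - 1))"
    by (simp only: of_nat_mult of_nat_J_exp p0) simp
qed

lemma S_neg_left:
  assumes "w \<in> V"
  shows "S_neg w + J_of (S_neg w) *\<^sub>v w = 0\<^sub>v p"
  unfolding J_of_S_neg[OF assms] using assms by (simp add: S_neg_def)

lemma S_neg_right:
  assumes "w \<in> V"
  shows "w + J_of w *\<^sub>v S_neg w = 0\<^sub>v p"
proof -
  have "J_of w * J ^\<^sub>m ((p - 1) * J_exp w) = J ^\<^sub>m (p * J_exp w)"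
    using two_le_p by (simp add: J_of_def pow_mat_add[of J p, symmetric] flip: add_mult_distrib)
      (simp add: algebra_simps)
  also have "\<dots> = 1\<^sub>m p"
    by (simp add: pow_mat_mult[of J p] J_pow_p one_pow_mat)
  finally have 1: "J_of w * J ^\<^sub>m ((p - 1) * J_exp w) = 1\<^sub>m p" .
  have "J_of w *\<^sub>v S_neg w = - (J_of w * J ^\<^sub>m ((p - 1) * J_exp w) *\<^sub>v w)"
    using assms by (simp add: S_neg_def mult_mat_vec_uminus[of _ p p] assoc_mult_mat_vec[of _ p p _ p])
  then show ?thesis using assms by (simp only: 1) simp
qed

lemma S_in_GL:
  assumes "w \<in> V"
  shows "S w \<in> carrier (GL (p + 1))"
proof (rule GL_memI[where B = "S (S_neg w)"])
  show "S w * S (S_neg w) = 1\<^sub>m (p + 1)" "S (S_neg w) * S w = 1\<^sub>m (p + 1)"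
    using assms by (simp_all only: S_mult S_neg_carrier S_neg_left S_neg_right S_zero)
qed (use assms in \<open>simp_all add: S_def block_carrier_mat\<close>)


section \<open>The group laws of \<open>N\<close>\<close>

lemma N_simps: "R \<otimes>\<^bsub>N\<^esub> T = R * T" "\<one>\<^bsub>N\<^esub> = 1\<^sub>m (p + 1)"
  by (simp_all add: N_group_def units_of_def ring_mat_def)

lemma carrier_N: "carrier N = {block (M ^\<^sub>m k) v | k v. v \<in> V}"
proof -
  have "block (M ^\<^sub>m k) v \<in> carrier N" if "v \<in> V" for k v
    using M_pow_cong[of k "k mod q"] that q_pos
    by (auto simp: N_group_def intro!: exI[of _ "k mod q"])
  then show ?thesis by (auto simp: N_group_def)
qed

lemma block_in_N: "v \<in> V \<Longrightarrow> block (M ^\<^sub>m k) v \<in> carrier N"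
  by (auto simp: carrier_N)

lemma N_cases:
  assumes "R \<in> carrier N"
  obtains k v where "R = block (M ^\<^sub>m k) v" "v \<in> V"
  using assms by (auto simp: carrier_N)

lemma block_M_pow_mult:
  assumes "v \<in> V" "w \<in> V"
  shows "block (M ^\<^sub>m j) v * block (M ^\<^sub>m k) w = block (M ^\<^sub>m (j + k)) (M ^\<^sub>m j *\<^sub>v w + v)"
  using assms by (simp add: block_mult[of _ p] pow_mat_add[OF M])

text \<open>The inverse of \<open>M^k\<close> is written as \<open>M^((q - 1) k)\<close>, again to
  keep natural exponents.\<close>

lemma block_M_pow_inverse:
  fixes k :: nat
  assumes "v \<in> V"
  defines "w \<equiv> - (M ^\<^sub>m ((q - 1) * k) *\<^sub>v v)"
  shows "block (M ^\<^sub>m k) v * block (M ^\<^sub>m ((q - 1) * k)) w = 1\<^sub>m (p + 1)"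
    and "block (M ^\<^sub>m ((q - 1) * k)) w * block (M ^\<^sub>m k) v = 1\<^sub>m (p + 1)"
proof -
  have w: "w \<in> V" using assms by simp
  have qk: "k + (q - 1) * k = q * k" "(q - 1) * k + k = q * k"
    using q_pos by (simp_all add: algebra_simps diff_mult_distrib)
  have "M ^\<^sub>m k *\<^sub>v w = - (M ^\<^sub>m k * M ^\<^sub>m ((q - 1) * k) *\<^sub>v v)"
    using assms by (simp add: mult_mat_vec_uminus[of _ p p] assoc_mult_mat_vec[of _ p p _ p])
  also have "\<dots> = - v"
    using assms by (simp add: pow_mat_add[OF M, symmetric] qk M_pow_dvd del: One_nat_def)
  finally have 1: "M ^\<^sub>m k *\<^sub>v w + v = 0\<^sub>v p" using assms by simp
  have 2: "M ^\<^sub>m ((q - 1) * k) *\<^sub>v v + w = 0\<^sub>v p"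
    using assms by (simp add: w_def)
  show "block (M ^\<^sub>m k) v * block (M ^\<^sub>m ((q - 1) * k)) w = 1\<^sub>m (p + 1)"
    "block (M ^\<^sub>m ((q - 1) * k)) w * block (M ^\<^sub>m k) v = 1\<^sub>m (p + 1)"
    unfolding block_M_pow_mult[OF assms(1) w] block_M_pow_mult[OF w assms(1)] 1 2 qk
    by (simp_all add: M_pow_dvd block_one)
qed

lemma block_in_GL:
  assumes "v \<in> V"
  shows "block (M ^\<^sub>m k) v \<in> carrier (GL (p + 1))"
  by (rule GL_memI[OF _ _ block_M_pow_inverse[OF assms, of k]])
    (use assms in \<open>simp_all add: block_carrier_mat\<close>)

lemma N_subset_GL: "carrier N \<subseteq> carrier (GL (p + 1))"
  by (auto simp: carrier_N block_in_GL)

lemma N_carrier_mat: "R \<in> carrier N \<Longrightarrow> R \<in> carrier_mat (p + 1) (p + 1)"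
  using N_subset_GL GL_carrier_mat by blast

lemma group_N: "group N"
proof (rule groupI)
  fix R T assume "R \<in> carrier N" "T \<in> carrier N"
  then show "R \<otimes>\<^bsub>N\<^esub> T \<in> carrier N"
    by (elim N_cases) (simp add: N_simps block_M_pow_mult block_in_N)
next
  have "1\<^sub>m (p + 1) = block (M ^\<^sub>m 0) (0\<^sub>v p)"
    using M by (simp add: block_one)
  then show "\<one>\<^bsub>N\<^esub> \<in> carrier N"
    unfolding N_simps by (simp only: block_in_N zero_carrier_vec)
next
  fix R T U assume "R \<in> carrier N" "T \<in> carrier N" "U \<in> carrier N"
  then show "R \<otimes>\<^bsub>N\<^esub> T \<otimes>\<^bsub>N\<^esub> U = R \<otimes>\<^bsub>N\<^esub> (T \<otimes>\<^bsub>N\<^esub> U)"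
    unfolding N_simps by (intro assoc_mult_mat[of _ "p + 1" "p + 1" _ "p + 1" _ "p + 1"] N_carrier_mat)
next
  fix R assume R: "R \<in> carrier N"
  then show "\<one>\<^bsub>N\<^esub> \<otimes>\<^bsub>N\<^esub> R = R"
    unfolding N_simps by (rule left_mult_one_mat[OF N_carrier_mat])
  from R obtain k v where kv: "R = block (M ^\<^sub>m k) v" "v \<in> V" by (rule N_cases)
  then have "block (M ^\<^sub>m ((q - 1) * k)) (- (M ^\<^sub>m ((q - 1) * k) *\<^sub>v v)) \<in> carrier N"
    by (intro block_in_N) simp
  then show "\<exists>T\<in>carrier N. T \<otimes>\<^bsub>N\<^esub> R = \<one>\<^bsub>N\<^esub>"
    unfolding kv(1) N_simps by (rule bexI[rotated]) (rule block_M_pow_inverse(2)[OF kv(2)])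
qed

text \<open>Instead of computing an inverse, the proof checks \<open>S w * R = R' * S w\<close> for
  the claimed image \<open>R'\<close> and then solves for \<open>R'\<close>. The exponent
  \<open>k'\<close> comes from moving \<open>J_of w\<close> past \<open>M^k\<close>.\<close>

lemma conj_by_S:
  fixes k :: nat
  assumes w: "w \<in> V" and v: "v \<in> V"
  defines "k' \<equiv> k * p ^ J_exp w"
  shows "conj_by p q M (S w) (block (M ^\<^sub>m k) v) =
    block (M ^\<^sub>m k') (J_of w *\<^sub>v v + w - M ^\<^sub>m k' *\<^sub>v w)"
    (is "_ = ?R")
proof -
  interpret GL: group "GL (p + 1) :: 'p mod_ring mat monoid" by (rule group_GL)
  have v': "J_of w *\<^sub>v v + w - M ^\<^sub>m k' *\<^sub>v w \<in> V"
    using w v by simp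
  have "S w * block (M ^\<^sub>m k) v = block (M ^\<^sub>m k' * J_of w) (J_of w *\<^sub>v v + w)"
    using w v by (simp add: S_def block_mult[of _ p] J_of_def J_pow_mult_M_pow k'_def)
  also have "J_of w *\<^sub>v v + w = M ^\<^sub>m k' *\<^sub>v w + (J_of w *\<^sub>v v + w - M ^\<^sub>m k' *\<^sub>v w)"
    using w v by (intro eq_vecI) (simp_all del: index_mult_mat_vec add: carrier_vecD[OF mult_vec_carrier(1)] carrier_vecD[OF J_of_mult_vec_carrier])
  also have "block (M ^\<^sub>m k' * J_of w) \<dots> = ?R * S w"
    using w v v' by (simp add: S_def block_mult[of _ p])
  finally have "S w * block (M ^\<^sub>m k) v = ?R * S w" .
  then have "S w \<otimes>\<^bsub>GL (p + 1)\<^esub> block (M ^\<^sub>m k) v = ?R \<otimes>\<^bsub>GL (p + 1)\<^esub> S w"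
    by (simp only: GL_simps)
  then have "?R = S w \<otimes>\<^bsub>GL (p + 1)\<^esub> block (M ^\<^sub>m k) v \<otimes>\<^bsub>GL (p + 1)\<^esub> inv\<^bsub>GL (p + 1)\<^esub> (S w)"
    using S_in_GL[OF w] block_in_GL[OF v, of k] block_in_GL[OF v', of k']
    by (subst GL.inv_solve_right) simp_all
  then show ?thesis
    using block_in_N[OF v, of k] by (simp add: conj_by_def)
qed

lemma conj_by_S_closed:
  assumes "w \<in> V" "R \<in> carrier N"
  shows "conj_by p q M (S w) R \<in> carrier N"
  using assms(2) by (rule N_cases) (use assms(1) in \<open>simp add: conj_by_S block_in_N\<close>)

lemma conj_by_S_mult:
  assumes w: "w \<in> V" and R: "R \<in> carrier N" and T: "T \<in> carrier N"
  shows "conj_by p q M (S w) (R * T) = conj_by p q M (S w) R * conj_by p q M (S w) T"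
proof -
  interpret GL: group "GL (p + 1) :: 'p mod_ring mat monoid" by (rule group_GL)
  interpret N: group N by (rule group_N)
  have c: "R \<in> carrier (GL (p + 1))" "T \<in> carrier (GL (p + 1))" "S w \<in> carrier (GL (p + 1))"
    using assms N_subset_GL S_in_GL by auto
  have RT: "R * T \<in> carrier N" using N.m_closed[OF R T] by (simp add: N_simps)
  have cancel: "inv\<^bsub>GL (p + 1)\<^esub> (S w) \<otimes>\<^bsub>GL (p + 1)\<^esub> (S w \<otimes>\<^bsub>GL (p + 1)\<^esub> x) = x"
    if "x \<in> carrier (GL (p + 1))" for x
    using that c by (simp flip: GL.m_assoc)
  show ?thesis using c R T RT unfolding GL_simps(1)[where n = "p + 1", symmetric]
    by (simp add: conj_by_def GL.m_assoc cancel)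
qed

lemma conj_by_S_S:
  assumes w: "w \<in> V" and w': "w' \<in> V" and R: "R \<in> carrier N"
  shows "conj_by p q M (S w) (conj_by p q M (S w') R) = conj_by p q M (S (w + J_of w *\<^sub>v w')) R"
proof -
  interpret GL: group "GL (p + 1) :: 'p mod_ring mat monoid" by (rule group_GL)
  have c: "R \<in> carrier (GL (p + 1))" "S w' \<in> carrier (GL (p + 1))" "S w \<in> carrier (GL (p + 1))"
    using assms N_subset_GL S_in_GL by auto
  show ?thesis
    using c R conj_by_S_closed[OF w' R]
    unfolding S_mult[OF w w', symmetric] GL_simps(1)[where n = "p + 1", symmetric]
    by (simp add: conj_by_def GL.m_assoc GL.inv_mult_group)
qed

lemma conj_by_S_zero:
  assumes "R \<in> carrier N"
  shows "conj_by p q M (S (0\<^sub>v p)) R = R"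
proof -
  interpret GL: group "GL (p + 1) :: 'p mod_ring mat monoid" by (rule group_GL)
  show ?thesis
    using assms N_subset_GL unfolding S_zero GL_simps(2)[symmetric] by (auto simp: conj_by_def)
qed

lemma conj_by_S_auto:
  assumes w: "w \<in> V"
  shows "conj_by p q M (S w) \<in> carrier (AutoGroup N)"
proof -
  have "conj_by p q M (S w) \<in> hom N N"
    using conj_by_S_closed[OF w] conj_by_S_mult[OF w] by (simp add: hom_def N_simps)
  moreover have "bij_betw (conj_by p q M (S w)) (carrier N) (carrier N)"
    using w by (intro bij_betw_byWitness[where f' = "conj_by p q M (S (S_neg w))"])
      (auto simp: conj_by_S_S S_neg_left S_neg_right conj_by_S_zero conj_by_S_closed)
  moreover have "conj_by p q M (S w) \<in> extensional (carrier N)"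
    by (simp add: conj_by_def)
  ultimately show ?thesis by (simp add: AutoGroup_def auto_def Bij_def)
qed

text \<open>The general element of \<open>G\<close>. The first component is chosen so that its
  product with \<open>S w\<close>, the left factor of the action, is \<open>M^k * J_of w\<close>
  with zero translation part.\<close>

definition E :: "nat \<Rightarrow> 'p mod_ring vec \<Rightarrow> 'p mod_ring mat \<times> ('p mod_ring mat \<Rightarrow> 'p mod_ring mat)" where
  "E k w = (block (M ^\<^sub>m k) (- (M ^\<^sub>m k *\<^sub>v w)), conj_by p q M (S w))"

lemma E_carrier:
  assumes "w \<in> V"
  shows "E k w \<in> carrier (Hol N)"
  using assms by (simp add: Hol_def E_def block_in_N conj_by_S_auto)

lemma Hol_mult_conj:
  assumes "w \<in> V" "w' \<in> V"
  shows "(R, conj_by p q M (S w)) \<otimes>\<^bsub>Hol N\<^esub> (T, conj_by p q M (S w')) =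
    (R * conj_by p q M (S w) T, conj_by p q M (S (w + J_of w *\<^sub>v w')))"
proof -
  have "compose (carrier N) (conj_by p q M (S w)) (conj_by p q M (S w')) =
      conj_by p q M (S (w + J_of w *\<^sub>v w'))"
    using assms by (intro extensionalityI[where A = "carrier N"])
      (simp_all add: compose_def conj_by_S_S, simp add: conj_by_def)
  then show ?thesis
    using assms conj_by_S_auto
    by (simp add: Hol_def N_simps AutoGroup_def BijGroup_def auto_def)
qed

text \<open>Left factors \<open>M^k * J_of w\<close> and right factors \<open>S w\<close> multiply
  separately; moving \<open>J_of w\<close> past \<open>M^k'\<close> twists the exponent
  \<open>k'\<close>.\<close>

lemma E_mult:
  assumes w: "w \<in> V" and w': "w' \<in> V"
  shows "E k w \<otimes>\<^bsub>Hol N\<^esub> E k' w' = E (k + k' * p ^ J_exp w) (w + J_of w *\<^sub>v w')"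
proof -
  define l where "l = k' * p ^ J_exp w"
  \<comment> \<open>By \<open>conj_by_S\<close> the conjugated factor has vector
    \<open>- u + w - x\<close>. In the product the \<open>w\<close> cancels, which leaves
    \<open>M^k\<close> applied to \<open>- (u + x)\<close>.\<close>
  define u where "u = M ^\<^sub>m l *\<^sub>v (J_of w *\<^sub>v w')"
  define x where "x = M ^\<^sub>m l *\<^sub>v w"
  have c: "u \<in> V" "x \<in> V" using w w' by (simp_all add: u_def x_def)
  have "J_of w *\<^sub>v (- (M ^\<^sub>m k' *\<^sub>v w')) = - ((J_of w * M ^\<^sub>m k') *\<^sub>v w')"
    using w' by (simp add: mult_mat_vec_uminus[of _ p p] assoc_mult_mat_vec[of _ p p _ p])
  also have "\<dots> = - u"
    using w' by (simp add: J_of_def J_pow_mult_M_pow assoc_mult_mat_vec[of _ p p _ p] u_def l_def)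
  finally have 1: "J_of w *\<^sub>v (- (M ^\<^sub>m k' *\<^sub>v w')) = - u" .
  have 2: "- u + w - x = - (u + x) + w"
    using c w by (intro eq_vecI) auto
  have 3: "M ^\<^sub>m (k + l) *\<^sub>v (w + J_of w *\<^sub>v w') = M ^\<^sub>m k *\<^sub>v (u + x)"
    using w w' by (simp add: pow_mat_add[OF M] assoc_mult_mat_vec[of _ p p _ p]
      mult_add_distrib_mat_vec[of _ p p] u_def x_def comm_add_vec[of _ p])
  have 4: "M ^\<^sub>m k *\<^sub>v (- (u + x) + w) + - (M ^\<^sub>m k *\<^sub>v w) = - (M ^\<^sub>m k *\<^sub>v (u + x))"
  proof -
    have "M ^\<^sub>m k *\<^sub>v (- (u + x) + w) = - (M ^\<^sub>m k *\<^sub>v (u + x)) + M ^\<^sub>m k *\<^sub>v w"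
      using c w by (simp add: mult_add_distrib_mat_vec[of _ p p] mult_mat_vec_uminus[of _ p p])
    then show ?thesis
      using c w by (intro eq_vecI) (simp_all del: index_mult_mat_vec)
  qed
  have "block (M ^\<^sub>m k) (- (M ^\<^sub>m k *\<^sub>v w)) * conj_by p q M (S w) (block (M ^\<^sub>m k') (- (M ^\<^sub>m k' *\<^sub>v w')))
      = block (M ^\<^sub>m (k + l)) (- (M ^\<^sub>m (k + l) *\<^sub>v (w + J_of w *\<^sub>v w')))"
    using w w' c unfolding 3
    by (simp add: conj_by_S 1 2 4 l_def[symmetric] x_def[symmetric] block_M_pow_mult)
  then show ?thesis
    unfolding E_def Hol_mult_conj[OF w w'] l_def by simp
qed


section \<open>The elements of \<open>G\<close>\<close>

abbreviation G :: "('p mod_ring mat \<times> ('p mod_ring mat \<Rightarrow> 'p mod_ring mat)) set" where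
  "G \<equiv> G_subgroup p q M"

text \<open>The left inverse of a pair of \<eta> and \<alpha> has components
  \<open>\<alpha>^(-1) (\<eta>^(-1))\<close> and \<open>\<alpha>^(-1)\<close>.\<close>

lemma group_Hol_N: "group (Hol N)"
proof -
  interpret N: group N by (rule group_N)
  interpret A: group "AutoGroup N" by (rule N.AutoGroup)
  let ?A = "carrier (AutoGroup N)"
  have hom: "\<alpha> \<in> hom N N" if "\<alpha> \<in> ?A" for \<alpha>
    using that by (auto simp: AutoGroup_def auto_def)
  note hom_simps = hom_in_carrier[OF hom] Group.hom_mult[OF hom] Group.hom_one[OF hom group_N group_N]
  have mult: "(\<alpha> \<otimes>\<^bsub>AutoGroup N\<^esub> \<beta>) x = \<alpha> (\<beta> x)" if "\<alpha> \<in> ?A" "\<beta> \<in> ?A" "x \<in> carrier N" for \<alpha> \<beta> x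
    using that by (simp add: AutoGroup_def BijGroup_def auto_def compose_def)
  have one: "\<one>\<^bsub>AutoGroup N\<^esub> x = x" if "x \<in> carrier N" for x
    using that by (simp add: AutoGroup_def BijGroup_def)
  show ?thesis
  proof (rule groupI)
    fix x assume "x \<in> carrier (Hol N)"
    then obtain \<eta> \<alpha> where x: "x = (\<eta>, \<alpha>)" "\<eta> \<in> carrier N" "\<alpha> \<in> ?A"
      by (auto simp: Hol_def)
    let ?b = "inv\<^bsub>AutoGroup N\<^esub> \<alpha>"
    have "?b (inv\<^bsub>N\<^esub> \<eta>) \<otimes>\<^bsub>N\<^esub> ?b \<eta> = ?b (inv\<^bsub>N\<^esub> \<eta> \<otimes>\<^bsub>N\<^esub> \<eta>)"
      using x by (simp only: hom_simps A.inv_closed N.inv_closed)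
    then have "?b (inv\<^bsub>N\<^esub> \<eta>) \<otimes>\<^bsub>N\<^esub> ?b \<eta> = \<one>\<^bsub>N\<^esub>"
      using x by (simp add: hom_simps)
    then show "\<exists>y\<in>carrier (Hol N). y \<otimes>\<^bsub>Hol N\<^esub> x = \<one>\<^bsub>Hol N\<^esub>"
      using x by (intro bexI[of _ "(?b (inv\<^bsub>N\<^esub> \<eta>), ?b)"]) (auto simp: Hol_def hom_simps)
  qed (auto simp: Hol_def hom_simps mult one N.m_assoc A.m_assoc)
qed

lemma E_one:
  assumes "q dvd k"
  shows "E k (0\<^sub>v p) = \<one>\<^bsub>Hol N\<^esub>"
proof -
  have "conj_by p q M (S (0\<^sub>v p)) = \<one>\<^bsub>AutoGroup N\<^esub>"
    by (intro extensionalityI[where A = "carrier N"])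
      (simp_all add: AutoGroup_def BijGroup_def conj_by_S_zero, simp add: conj_by_def)
  then show ?thesis
    using assms by (simp add: E_def Hol_def M_pow_dvd N_simps block_one)
qed

text \<open>The exponent of the left factor makes the total exponent of \<open>M\<close> a multiple
  of \<open>q\<close>.\<close>

lemma E_inverse:
  assumes "w \<in> V"
  shows "E ((q - 1) * (k * p ^ J_exp (S_neg w))) (S_neg w) \<otimes>\<^bsub>Hol N\<^esub> E k w = \<one>\<^bsub>Hol N\<^esub>"
proof -
  have "(q - 1) * (k * p ^ J_exp (S_neg w)) + k * p ^ J_exp (S_neg w) = q * (k * p ^ J_exp (S_neg w))"
    using q_pos by (cases q) simp_all
  then show ?thesis
    using assms by (simp only: E_mult S_neg_carrier S_neg_left E_one dvd_triv_left)
qed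

text \<open>It contains the three generators and thus bounds \<open>G\<close> from above.\<close>

lemma subgroup_E: "subgroup {E k w | k w. w \<in> V} (Hol N)"
proof -
  interpret Hol: group "Hol N" by (rule group_Hol_N)
  show ?thesis
  proof (rule Hol.subgroupI)
    show "{E k w | k w. w \<in> V} \<noteq> {}"
      using zero_carrier_vec by blast
  next
    fix a assume "a \<in> {E k w | k w. w \<in> V}"
    then obtain k w where a: "a = E k w" "w \<in> V" by blast
    then have "inv\<^bsub>Hol N\<^esub> a = E ((q - 1) * (k * p ^ J_exp (S_neg w))) (S_neg w)"
      by (intro Hol.inv_equality) (simp_all add: E_inverse E_carrier)
    then show "inv\<^bsub>Hol N\<^esub> a \<in> {E k w | k w. w \<in> V}"
      using a S_neg_carrier by blast
  next
    fix a b assume "a \<in> {E k w | k w. w \<in> V}" "b \<in> {E k w | k w. w \<in> V}"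
    then obtain k w l u where "a = E k w" "w \<in> V" "b = E l u" "u \<in> V" by blast
    then have "a \<otimes>\<^bsub>Hol N\<^esub> b = E (k + l * p ^ J_exp w) (w + J_of w *\<^sub>v u)" "w + J_of w *\<^sub>v u \<in> V"
      by (simp_all add: E_mult)
    then show "a \<otimes>\<^bsub>Hol N\<^esub> b \<in> {E k w | k w. w \<in> V}" by blast
  qed (auto simp: E_carrier)
qed

section \<open>The generators written as elements \<open>E k w\<close>\<close>

lemma S_no_last:
  assumes "w $ (p - 1) = 0"
  shows "S w = block (1\<^sub>m p) w"
  using assms by (simp add: S_def J_of_no_last)

lemma X_elem_eq: "X_elem p q M = E 1 (0\<^sub>v p)"
proof -
  have "M ^\<^sub>m 1 = M" by (simp add: One_nat_def)
  moreover have "M *\<^sub>v 0\<^sub>v p = 0\<^sub>v p" using M by (intro eq_vecI) auto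
  ultimately show ?thesis
    using two_le_p by (simp add: X_elem_def E_def S_no_last)
qed

lemma Y_elem_eq:
  assumes "v \<in> V" "v $ (p - 1) = 0"
  shows "Y_elem p q M v = E 0 (- v)"
  using assms two_le_p by (simp add: Y_elem_def E_def S_no_last)

text \<open>The last coordinate of \<open>- basis_vec p p\<close> is -1, so the exponent of
  \<open>J\<close> is 1, as in the definition of \<open>Z_elem\<close>.\<close>

lemma Z_elem_eq: "Z_elem p q M = E 0 (- basis_vec p p)"
proof -
  have "J_of (- basis_vec p p) = J ^\<^sub>m 1"
    using two_le_p by (intro J_of_eq) (simp add: basis_vec_def)
  then have "S (- basis_vec p p) = block J (- basis_vec p p)"
    by (simp add: S_def One_nat_def)
  then show ?thesis
    by (simp add: Z_elem_def E_def basis_vec_def)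
qed

lemma basis_vec_carrier [simp]: "basis_vec p i \<in> V" "dim_vec (basis_vec p i) = p"
  by (simp_all add: basis_vec_def)

text \<open>Indices start at 0: \<open>basis_vec p (p - 1)\<close> is
  \<open>unit_vec p (p - 2)\<close>, whereas the last coordinate has index
  \<open>p - 1\<close>.\<close>

lemma basis_vec_last_but_one: "basis_vec p (p - 1) $ (p - 1) = (0 :: 'p mod_ring)"
  using two_le_p by (simp add: basis_vec_def)

lemma G_eq_generate:
  "G = generate (Hol N) {E 1 (0\<^sub>v p), E 0 (- basis_vec p (p - 1)), E 0 (- basis_vec p p)}"
  using Y_elem_eq[OF _ basis_vec_last_but_one] by (simp add: G_subgroup_def X_elem_eq Z_elem_eq)

lemma G_subset: "G \<subseteq> {E k w | k w. w \<in> V}"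
proof -
  interpret Hol: group "Hol N" by (rule group_Hol_N)
  have "E k w \<in> {E k w | k w. w \<in> V}" if "w \<in> V" for k w
    using that by blast
  then show ?thesis unfolding G_eq_generate
    by (intro Hol.generate_subgroup_incl[OF _ subgroup_E])
      (simp only: insert_subset empty_subsetI simp_thms basis_vec_carrier uminus_carrier_vec zero_carrier_vec)
qed

lemma subgroup_G: "subgroup G (Hol N)"
proof -
  interpret Hol: group "Hol N" by (rule group_Hol_N)
  show ?thesis unfolding G_eq_generate
    by (rule Hol.generate_is_subgroup) (simp add: E_carrier)
qed

lemma E_generators_in_G:
  "E 1 (0\<^sub>v p) \<in> G" "E 0 (- basis_vec p (p - 1)) \<in> G" "E 0 (- basis_vec p p) \<in> G"
  unfolding G_eq_generate by (simp_all add: generate.incl)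

section \<open>Every \<open>E k w\<close> lies in \<open>G\<close>\<close>

lemma translation_mult:
  assumes "w \<in> V" "w' \<in> V" "E 0 w \<in> G" "E 0 w' \<in> G"
  shows "E 0 (w + J_of w *\<^sub>v w') \<in> G"
  using subgroup.m_closed[OF subgroup_G assms(3,4)] E_mult[OF assms(1,2), of 0 0] by simp

lemma translation_add:
  assumes "w \<in> V" "w' \<in> V" "E 0 w \<in> G" "E 0 w' \<in> G" "w $ (p - 1) = 0"
  shows "E 0 (w + w') \<in> G"
  using translation_mult[OF assms(1-4)] assms by (simp add: J_of_no_last)

lemma translation_inverse:
  assumes "w \<in> V" "E 0 w \<in> G"
  shows "E 0 (S_neg w) \<in> G"
proof -
  interpret Hol: group "Hol N" by (rule group_Hol_N)
  have "inv\<^bsub>Hol N\<^esub> (E 0 w) = E 0 (S_neg w)"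
    using E_inverse[OF assms(1), of 0] assms(1)
    by (intro Hol.inv_equality) (simp_all add: E_carrier)
  then show ?thesis using subgroup.m_inv_closed[OF subgroup_G assms(2)] by simp
qed

text \<open>The result is the conjugate of \<open>E 0 w'\<close> by \<open>E 0 w\<close>: as
  \<open>J_of w' = 1\<close>, the twists by \<open>w\<close> and by its inverse cancel, and so do
  their vectors.\<close>

lemma translation_conj:
  assumes w: "w \<in> V" "E 0 w \<in> G" and w': "w' \<in> V" "E 0 w' \<in> G" "w' $ (p - 1) = 0"
  shows "E 0 (J_of w *\<^sub>v w') \<in> G"
proof -
  let ?u = "w + J_of w *\<^sub>v w'"
  have u: "?u \<in> V" "E 0 ?u \<in> G"
    using translation_mult[OF w(1) w'(1) w(2) w'(2)] w w' by simp_all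
  have "J_of ?u = J_of w"
    using w w' by (simp add: J_of_add J_of_no_last right_mult_one_mat[of _ p p])
  then have "E 0 (?u + J_of w *\<^sub>v S_neg w) \<in> G"
    using translation_mult[OF u(1) S_neg_carrier[OF w(1)] u(2) translation_inverse[OF w]] by simp
  also have "?u + J_of w *\<^sub>v S_neg w = J_of w *\<^sub>v w' + (w + J_of w *\<^sub>v S_neg w)"
    using w w' by (intro eq_vecI) (simp_all del: index_mult_mat_vec add: carrier_vecD[OF J_of_mult_vec_carrier])
  finally show ?thesis using w w' by (simp add: S_neg_right)
qed

text \<open>Scalars lie in the prime field, so scaling is repeated addition, which is untwisted for
  last coordinate 0.\<close>

lemma translation_smult:
  assumes "w \<in> V" "E 0 w \<in> G" "w $ (p - 1) = 0"
  shows "E 0 (c \<cdot>\<^sub>v w) \<in> G"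
proof -
  have last: "(a \<cdot>\<^sub>v w) $ (p - 1) = 0" for a using assms two_le_p by simp
  have "E 0 (of_nat n \<cdot>\<^sub>v w) \<in> G" for n
  proof (induction n)
    case 0
    have "of_nat 0 \<cdot>\<^sub>v w = 0\<^sub>v p" using assms by (intro eq_vecI) auto
    then show ?case
      using subgroup.one_closed[OF subgroup_G] by (simp only: E_one dvd_0_right)
  next
    case (Suc n)
    have "of_nat (Suc n) \<cdot>\<^sub>v w = of_nat n \<cdot>\<^sub>v w + w"
      using assms by (intro eq_vecI) (auto simp: algebra_simps)
    then show ?case
      using translation_add[of "of_nat n \<cdot>\<^sub>v w" w] Suc assms last by simp
  qed
  then show ?thesis using surj_of_nat_mod_ring[of c] by metis
qed

text \<open>The generator \<open>Y_elem\<close> supplies index \<open>p - 2\<close>. Conjugation by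
  \<open>Z_elem\<close> applies \<open>J\<close>, and \<open>J - 1\<close> sends the unit vector of
  index \<open>i + 1\<close> to that of index \<open>i\<close>.\<close>

lemma translation_unit_vec:
  assumes "i + 2 \<le> p"
  shows "E 0 (unit_vec p i) \<in> G"
proof -
  have "j + 2 \<le> p \<Longrightarrow> E 0 (unit_vec p (p - 2 - j)) \<in> G" for j
  proof (induction j)
    case 0
    have "E 0 ((- 1) \<cdot>\<^sub>v (- basis_vec p (p - 1))) \<in> G"
      using two_le_p basis_vec_last_but_one by (intro translation_smult E_generators_in_G) simp_all
    also have "(- 1) \<cdot>\<^sub>v (- basis_vec p (p - 1)) = (unit_vec p (p - 2 - 0) :: 'p mod_ring vec)"
      using two_le_p by (intro eq_vecI) (auto simp: basis_vec_def numeral_2_eq_2 One_nat_def)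
    finally show ?case .
  next
    case (Suc j)
    define i where "i = p - 2 - Suc j"
    have i: "p - 2 - j = Suc i" "Suc i < p" "Suc i \<noteq> p - 1" using Suc.prems by (auto simp: i_def)
    have IH: "E 0 (unit_vec p (Suc i)) \<in> G" using Suc i by simp
    have JJ: "J_of (- basis_vec p p) = J"
      using two_le_p J_of_eq[of 1 "- basis_vec p p"] by (simp add: basis_vec_def One_nat_def)
    have "E 0 (J *\<^sub>v unit_vec p (Suc i)) \<in> G"
      using translation_conj[of "- basis_vec p p" "unit_vec p (Suc i)"] IH i E_generators_in_G(3)
      by (simp add: JJ)
    then have "E 0 ((- 1) \<cdot>\<^sub>v unit_vec p (Suc i) + J *\<^sub>v unit_vec p (Suc i)) \<in> G"
      using i IH mult_mat_vec_carrier[of J p p "unit_vec p (Suc i)"] 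
      by (intro translation_add translation_smult) simp_all
    also have "(- 1) \<cdot>\<^sub>v unit_vec p (Suc i) + J *\<^sub>v unit_vec p (Suc i) = unit_vec p i"
      using i by (intro eq_vecI) (auto simp: jordan_block_one_mult_vec unit_vec_def simp del: index_mult_mat_vec)
    finally show ?case by (simp add: i_def)
  qed
  moreover have "p - 2 - (p - 2 - i) = i" "p - 2 - i + 2 \<le> p" using assms by simp_all
  ultimately show ?thesis by metis
qed

lemma translation_no_last:
  assumes "w \<in> V" "w $ (p - 1) = 0"
  shows "E 0 w \<in> G"
proof -
  \<comment> \<open>Induction on a bound \<open>n\<close> for the support; each step splits off the
    coordinate of index \<open>n\<close>.\<close>
  have "E 0 w \<in> G" if "n \<le> p - 1" "w \<in> V" "\<And>j. n \<le> j \<Longrightarrow> j < p \<Longrightarrow> w $ j = 0" for n w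
    using that
  proof (induction n arbitrary: w)
    case 0
    then have "w = 0\<^sub>v p" by (intro eq_vecI) auto
    then show ?case
      using subgroup.one_closed[OF subgroup_G] by (simp only: E_one dvd_0_right)
  next
    case (Suc n)
    define u where "u = vec p (\<lambda>j. if j = n then 0 else w $ j)"
    have u: "u \<in> V" "E 0 u \<in> G"
      using Suc.prems by (auto simp: u_def intro!: Suc.IH)
    have ul: "u $ (p - 1) = 0" using Suc.prems two_le_p by (simp add: u_def)
    have n: "n + 2 \<le> p" using Suc.prems two_le_p by simp
    have "E 0 (u + w $ n \<cdot>\<^sub>v unit_vec p n) \<in> G"
      using n by (intro translation_add u ul translation_smult translation_unit_vec) auto
    also have "u + w $ n \<cdot>\<^sub>v unit_vec p n = w"
      using n Suc.prems(2) by (intro eq_vecI) (auto simp: u_def)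
    finally show ?case .
  qed
  from this[of "p - 1" w] show ?thesis
    using assms by (metis le_antisym less_Suc_eq_le order_refl Suc_diff_1 prime_gt_0_nat prime_p)
qed

text \<open>Products with \<open>Z_elem\<close> reach every last coordinate; the remaining
  difference has last coordinate 0.\<close>

lemma translation_in_G:
  assumes "w \<in> V"
  shows "E 0 w \<in> G"
proof -
  have "\<exists>z\<in>V. z $ (p - 1) = - of_nat n \<and> E 0 z \<in> G" for n
  proof (induction n)
    case 0
    show ?case
      using translation_no_last[of "0\<^sub>v p"] two_le_p by (intro bexI[of _ "0\<^sub>v p"]) simp_all
  next
    case (Suc n)
    then obtain z where z: "z \<in> V" "z $ (p - 1) = - of_nat n" "E 0 z \<in> G" by blast
    let ?b = "- basis_vec p p :: 'p mod_ring vec"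
    \<comment> \<open>Multiplying by \<open>Z_elem\<close> on the left lowers the last coordinate by
      one.\<close>
    have "(?b + J_of ?b *\<^sub>v z) $ (p - 1) = - of_nat (Suc n)"
      using z two_le_p J_mult_vec_last[OF z(1), of "J_exp ?b"]
      by (simp add: J_of_def basis_vec_def del: index_mult_mat_vec)
    moreover have "E 0 (?b + J_of ?b *\<^sub>v z) \<in> G"
      using z E_generators_in_G(3) by (intro translation_mult) simp_all
    ultimately show ?case
      using z by (intro bexI[of _ "?b + J_of ?b *\<^sub>v z"]) simp_all
  qed
  moreover obtain n where "- (w $ (p - 1)) = of_nat n"
    using surj_of_nat_mod_ring by metis
  ultimately obtain z where z: "z \<in> V" "z $ (p - 1) = w $ (p - 1)" "E 0 z \<in> G"
    by (metis minus_minus)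
  then have "E 0 ((w - z) + z) \<in> G"
    using assms two_le_p by (intro translation_add translation_no_last[of "w - z"]) auto
  also have "w - z + z = w"
    using assms z by (intro eq_vecI) auto
  finally show ?thesis .
qed

text \<open>\<open>E k w\<close> is the product of the \<open>k\<close>-th power of
  \<open>X_elem\<close> and \<open>E 0 w\<close>; no twist occurs because \<open>J_of\<close> is
  trivial at the zero vector.\<close>

lemma E_in_G:
  assumes "w \<in> V"
  shows "E k w \<in> G"
proof -
  have 0: "J_exp (0\<^sub>v p) = 0" "J_of (0\<^sub>v p) = 1\<^sub>m p"
    using two_le_p by (simp_all add: J_exp_no_last J_of_no_last)
  have "E k (0\<^sub>v p) \<in> G"
  proof (induction k)
    case (Suc k)
    have "E (Suc k) (0\<^sub>v p) = E k (0\<^sub>v p) \<otimes>\<^bsub>Hol N\<^esub> E 1 (0\<^sub>v p)"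
      by (simp add: E_mult 0 One_nat_def)
    then show ?case using subgroup.m_closed[OF subgroup_G Suc E_generators_in_G(1)] by simp
  qed (simp add: translation_in_G)
  then have "E k (0\<^sub>v p) \<otimes>\<^bsub>Hol N\<^esub> E 0 w \<in> G"
    by (intro subgroup.m_closed[OF subgroup_G] translation_in_G assms)
  then show ?thesis using assms by (simp add: E_mult 0)
qed

lemma M_pow_inverse_vec:
  assumes "v \<in> V"
  shows "M ^\<^sub>m k *\<^sub>v (M ^\<^sub>m ((q - 1) * k) *\<^sub>v v) = v"
    and "M ^\<^sub>m ((q - 1) * k) *\<^sub>v (M ^\<^sub>m k *\<^sub>v v) = v"
proof -
  have qk: "k + (q - 1) * k = q * k" "(q - 1) * k + k = q * k"
    using q_pos by (simp_all add: algebra_simps diff_mult_distrib)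
  show "M ^\<^sub>m k *\<^sub>v (M ^\<^sub>m ((q - 1) * k) *\<^sub>v v) = v"
    "M ^\<^sub>m ((q - 1) * k) *\<^sub>v (M ^\<^sub>m k *\<^sub>v v) = v"
    using assms by (simp_all add: assoc_mult_mat_vec[of _ p p _ p, symmetric]
      pow_mat_add[OF M, symmetric] qk M_pow_dvd del: assoc_mult_mat_vec)
qed

text \<open>The first component determines \<open>M^k\<close>, and then \<open>w\<close> by
  invertibility. The number \<open>k\<close> itself need not be recovered, since \<open>E\<close>
  depends only on the power.\<close>

lemma element_over_E:
  assumes w: "w \<in> V"
  shows "element_over G (block (M ^\<^sub>m k) (- (M ^\<^sub>m k *\<^sub>v w))) = E k w"
  unfolding element_over_def
proof (rule the_equality)
  show "E k w \<in> G \<and> fst (E k w) = block (M ^\<^sub>m k) (- (M ^\<^sub>m k *\<^sub>v w))"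
    using E_in_G[OF w] by (simp add: E_def)
next
  fix g assume g: "g \<in> G \<and> fst g = block (M ^\<^sub>m k) (- (M ^\<^sub>m k *\<^sub>v w))"
  then obtain l u where lu: "g = E l u" "u \<in> V" using G_subset by blast
  then have 1: "block (M ^\<^sub>m l) (- (M ^\<^sub>m l *\<^sub>v u)) = block (M ^\<^sub>m k) (- (M ^\<^sub>m k *\<^sub>v w))"
    using g by (simp add: E_def)
  have l: "M ^\<^sub>m l = M ^\<^sub>m k"
    using 1 lu w by (simp add: block_eq_iff[of _ p])
  have eq: "M ^\<^sub>m k *\<^sub>v u = M ^\<^sub>m k *\<^sub>v w"
    using 1 lu w unfolding l by (simp add: block_eq_iff[of _ p])
  have "u = w"
    using M_pow_inverse_vec(2)[OF lu(2), of k] M_pow_inverse_vec(2)[OF w, of k] by (metis eq)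
  then show "g = E k w" using lu l by (simp add: E_def)
qed

lemma element_over_translation:
  assumes "v \<in> V"
  shows "element_over G (block (1\<^sub>m p) v) = E 0 (- v)"
  using element_over_E[of "- v" 0] assms by simp

text \<open>Solving \<open>v = - M^k w\<close> for \<open>w\<close> shows that each element of
  \<open>N\<close> is a first component in \<open>G\<close>.\<close>

lemma fst_element_over:
  assumes "R \<in> carrier N"
  shows "fst (element_over G R) = R"
proof -
  from assms obtain k v where R: "R = block (M ^\<^sub>m k) v" "v \<in> V" by (rule N_cases)
  define w where "w = - (M ^\<^sub>m ((q - 1) * k) *\<^sub>v v)"
  have w: "w \<in> V" using R by (simp add: w_def)
  have "R = block (M ^\<^sub>m k) (- (M ^\<^sub>m k *\<^sub>v w))"
    using R by (simp add: w_def mult_mat_vec_uminus[of _ p p] M_pow_inverse_vec)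
  then show ?thesis using element_over_E[OF w, of k] by (simp add: E_def)
qed


section \<open>The circle operation of the brace\<close>

abbreviation C :: "'p mod_ring mat monoid" where
  "C \<equiv> circ_group (skew_brace_of N G)"

lemma carrier_C: "carrier C = carrier N"
  by (simp add: skew_brace_of_def)

lemma circ_mult:
  assumes "R \<in> carrier N" "T \<in> carrier N"
  shows "R \<otimes>\<^bsub>C\<^esub> T = R * snd (element_over G R) T"
  using assms by (simp add: skew_brace_of_def Hol_def split_beta fst_element_over N_simps)

text \<open>Write \<open>c\<close> for the translation. Its conjugating matrix is
  \<open>c^(-1)\<close>, so the circle product is \<open>c * (c^(-1) * R * c)\<close>.\<close>

lemma circ_translation:
  assumes v: "v \<in> V" "v $ (p - 1) = 0" and R: "R \<in> carrier N"
  shows "block (1\<^sub>m p) v \<otimes>\<^bsub>C\<^esub> R = R * block (1\<^sub>m p) v"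
proof -
  from R obtain k u where ku: "R = block (M ^\<^sub>m k) u" "u \<in> V" by (rule N_cases)
  have v0: "block (1\<^sub>m p) v \<in> carrier N" using block_in_N[OF v(1), of 0] by simp
  have last: "(- v) $ (p - 1) = 0" using v two_le_p by simp
  have "u + - v - M ^\<^sub>m k *\<^sub>v (- v) + v = M ^\<^sub>m k *\<^sub>v v + u"
    using ku v by (intro eq_vecI) (simp_all add: mult_mat_vec_uminus[of _ p p] del: index_mult_mat_vec)
  then show ?thesis
    using ku v last unfolding circ_mult[OF v0 R]
    by (simp add: element_over_translation E_def conj_by_S J_exp_no_last J_of_no_last
      block_mult[of _ p])
qed

text \<open>Otherwise \<open>j\<close> would be invertible modulo \<open>q\<close>, and
  \<open>M\<close> would be a power of \<open>M^j = 1\<close>.\<close>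

lemma M_pow_eq_oneD:
  assumes "M ^\<^sub>m j = 1\<^sub>m p"
  shows "q dvd j"
proof (rule ccontr)
  assume "\<not> q dvd j"
  then have "coprime j q"
    using prime_imp_coprime[OF prime_q] by (simp add: coprime_commute)
  then obtain x where "[j * x = Suc 0] (mod q)"
    using cong_solve_coprime_nat by blast
  then have "M ^\<^sub>m (j * x) = M ^\<^sub>m 1"
    by (intro M_pow_cong) (simp add: cong_def One_nat_def)
  then show False
    using assms M_ne_one by (simp add: pow_mat_mult[OF M] one_pow_mat One_nat_def)
qed

section \<open>Fixed vectors of \<open>M\<close>\<close>

text \<open>The nilpotent part \<open>J - 1\<close>, which shifts coordinates down by one
  index.\<close>

definition J_diff :: "'p mod_ring vec \<Rightarrow> 'p mod_ring vec" where
  "J_diff x = J *\<^sub>v x - x"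

lemma J_vec_carrier [simp]: "x \<in> V \<Longrightarrow> J *\<^sub>v x \<in> V"
  by (rule mult_mat_vec_carrier[of _ p p]) simp_all

lemma M_vec_carrier [simp]: "x \<in> V \<Longrightarrow> M *\<^sub>v x \<in> V"
  by (rule mult_mat_vec_carrier[OF M])

lemma J_diff_index:
  assumes "x \<in> V" "i < p"
  shows "J_diff x $ i = (if Suc i < p then x $ Suc i else 0)"
  using assms by (simp add: J_diff_def jordan_block_one_mult_vec del: index_mult_mat_vec)

text \<open>Each shift lowers the largest index of a nonzero coordinate until only index 0 remains.
  \<open>W\<close> is merely closed under the shift, hence only some nonzero multiple is
  obtained.\<close>

lemma J_diff_invariant_multiple_first:
  assumes "W \<subseteq> V" and "\<And>x. x \<in> W \<Longrightarrow> J_diff x \<in> W" and "x \<in> W" "x \<noteq> 0\<^sub>v p"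
  obtains c where "c \<noteq> 0" "c \<cdot>\<^sub>v unit_vec p 0 \<in> W"
proof -
  have *: "\<exists>c. c \<noteq> 0 \<and> c \<cdot>\<^sub>v unit_vec p 0 \<in> W"
    if "x \<in> W" "t < p" "x $ t \<noteq> 0" "\<And>j. t < j \<Longrightarrow> j < p \<Longrightarrow> x $ j = 0" for t x
    using that
  proof (induction t arbitrary: x)
    case 0
    then have "x = x $ 0 \<cdot>\<^sub>v unit_vec p 0"
      using assms(1) by (intro eq_vecI) auto
    then show ?case using 0 by metis
  next
    case (Suc t)
    then have x: "x \<in> V" using assms(1) by blast
    show ?case
      by (rule Suc.IH[of "J_diff x"]) (use Suc.prems x assms(2) in \<open>auto simp: J_diff_index\<close>)
  qed
  have x: "x \<in> V" using assms by blast
  have "\<exists>i<p. x $ i \<noteq> 0"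
    using assms(4) x by (metis carrier_vecD eq_vecI index_zero_vec)
  then obtain t where "t < p" "x $ t \<noteq> 0" "\<And>j. t < j \<Longrightarrow> j < p \<Longrightarrow> x $ j = 0"
    using ex_has_greatest_nat[of "\<lambda>i. i < p \<and> x $ i \<noteq> 0" _ id p]
    by (metis id_apply leD)
  then show ?thesis using *[OF assms(3)] that by blast
qed

text \<open>As \<open>p\<close> is invertible modulo \<open>q\<close>, the matrix \<open>M\<close>
  is itself a power of \<open>M^p\<close>.\<close>

lemma M_pow_fixed:
  assumes x: "x \<in> V" and fixed: "M ^\<^sub>m p *\<^sub>v x = x"
  shows "M *\<^sub>v x = x"
proof -
  have "coprime p q" using primes_coprime[OF prime_p prime_q p_ne_q] .
  then obtain y where "[p * y = Suc 0] (mod q)"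
    using cong_solve_coprime_nat by blast
  then have "M ^\<^sub>m (p * y) = M ^\<^sub>m 1"
    by (intro M_pow_cong) (simp add: cong_def One_nat_def)
  then have "M = (M ^\<^sub>m p) ^\<^sub>m y"
    by (simp add: pow_mat_mult[OF M] One_nat_def)
  then show ?thesis
    using pow_mat_fixed[OF _ x fixed, of y] by simp
qed

lemma J_mult_M_vec:
  assumes "x \<in> V"
  shows "J *\<^sub>v (M *\<^sub>v x) = M ^\<^sub>m p *\<^sub>v (J *\<^sub>v x)"
  using assms J_mult_M M by (simp add: assoc_mult_mat_vec[of _ p p _ p, symmetric] del: assoc_mult_mat_vec)

text \<open>\<open>M^n - 1\<close> has \<open>M - 1\<close> as a factor; the induction
  telescopes.\<close>

lemma M_pow_diff:
  assumes "x \<in> V"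
  shows "\<exists>u\<in>V. M ^\<^sub>m n *\<^sub>v x - x = M *\<^sub>v u - u"
proof (induction n)
  case 0
  show ?case using assms M by (intro bexI[of _ "0\<^sub>v p"]) (auto intro!: eq_vecI)
next
  case (Suc n)
  then obtain u where u: "u \<in> V" "M ^\<^sub>m n *\<^sub>v x - x = M *\<^sub>v u - u" by blast
  define y where "y = M ^\<^sub>m n *\<^sub>v x"
  have y: "y \<in> V" using assms by (simp add: y_def)
  have "M ^\<^sub>m Suc n = M * M ^\<^sub>m n"
    using pow_mat_add[OF M, of 1 n] M by (simp add: One_nat_def)
  then have "M ^\<^sub>m Suc n *\<^sub>v x = M *\<^sub>v y"
    using assms M by (simp add: assoc_mult_mat_vec[of _ p p _ p] y_def)
  then have "M ^\<^sub>m Suc n *\<^sub>v x - x = (M *\<^sub>v y - y) + (y - x)"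
    using assms y by (intro eq_vecI) (simp_all del: index_mult_mat_vec pow_mat.simps)
  also have "\<dots> = (M *\<^sub>v y - y) + (M *\<^sub>v u - u)"
    using u by (simp add: y_def)
  also have "\<dots> = (M *\<^sub>v y + M *\<^sub>v u) - (y + u)"
    using u y by (intro eq_vecI) (simp_all del: index_mult_mat_vec)
  also have "\<dots> = M *\<^sub>v (y + u) - (y + u)"
    using u y M by (simp add: mult_add_distrib_mat_vec[of _ p p])
  finally show ?case using u y by (intro bexI[of _ "y + u"]) simp_all
qed

text \<open>From \<open>J M = M^p J\<close>, the vector \<open>J x\<close> is fixed by
  \<open>M^p\<close>, hence by \<open>M\<close>.\<close>

lemma J_diff_fixed:
  assumes "x \<in> V" "M *\<^sub>v x = x"
  shows "M *\<^sub>v J_diff x = J_diff x"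
proof -
  have "M *\<^sub>v (J *\<^sub>v x) = J *\<^sub>v x"
    using J_mult_M_vec[OF assms(1)] assms by (intro M_pow_fixed) simp_all
  then show ?thesis
    using assms M by (simp add: J_diff_def mult_minus_distrib_mat_vec[of _ p p])
qed

text \<open>\<open>J (M u - u)\<close> equals \<open>M^p (J u) - J u\<close>, which
  \<open>M_pow_diff\<close> places in the image of \<open>M - 1\<close>.\<close>

lemma J_diff_image:
  assumes "u \<in> V"
  shows "\<exists>u'\<in>V. J_diff (M *\<^sub>v u - u) = M *\<^sub>v u' - u'"
proof -
  obtain z where z: "z \<in> V" "M ^\<^sub>m p *\<^sub>v (J *\<^sub>v u) - J *\<^sub>v u = M *\<^sub>v z - z"
    using M_pow_diff[of "J *\<^sub>v u" p] assms by auto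
  have "J_diff (M *\<^sub>v u - u) = (M *\<^sub>v z - z) - (M *\<^sub>v u - u)"
    using assms z by (simp add: J_diff_def mult_minus_distrib_mat_vec[of _ p p] J_mult_M_vec)
  also have "\<dots> = (M *\<^sub>v z - M *\<^sub>v u) - (z - u)"
    using assms z by (intro eq_vecI) (simp_all del: index_mult_mat_vec)
  also have "\<dots> = M *\<^sub>v (z - u) - (z - u)"
    using assms z M by (simp add: mult_minus_distrib_mat_vec[of _ p p])
  finally show ?thesis using assms z by (intro bexI[of _ "z - u"]) simp_all
qed

text \<open>Since \<open>J\<close> is a single Jordan block, two nonzero \<open>J\<close>-invariant subspaces both contain the first
  basis vector; this applies to the kernel and the image of \<open>M - 1\<close>, which nevertheless
  intersect trivially because \<open>q\<close> is prime to \<open>p\<close>.\<close>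

lemma M_fixed_eq_zero:
  assumes v: "v \<in> V" "M *\<^sub>v v = v"
  shows "v = 0\<^sub>v p"
proof (rule ccontr)
  assume "v \<noteq> 0\<^sub>v p"
  then obtain c where c: "c \<noteq> 0" "c \<cdot>\<^sub>v unit_vec p 0 \<in> {x \<in> V. M *\<^sub>v x = x}"
    using J_diff_invariant_multiple_first[of "{x \<in> V. M *\<^sub>v x = x}" v] v J_diff_fixed
    by (auto simp: J_diff_def)
  have "\<exists>u\<in>V. M *\<^sub>v u - u \<noteq> 0\<^sub>v p"
  proof (rule ccontr)
    assume *: "\<not> ?thesis"
    have fixed: "M *\<^sub>v u = u" if "u \<in> V" for u
    proof (rule eq_vecI)
      fix i assume i: "i < dim_vec u"
      have "(M *\<^sub>v u - u) $ i = 0\<^sub>v p $ i" using * that by simp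
      then show "(M *\<^sub>v u) $ i = u $ i" using i that by (simp del: index_mult_mat_vec)
    qed (use that in simp)
    have "M = 1\<^sub>m p"
    proof (rule eq_matI)
      fix i j assume "i < dim_row (1\<^sub>m p :: 'p mod_ring mat)" "j < dim_col (1\<^sub>m p :: 'p mod_ring mat)"
      then show "M $$ (i, j) = 1\<^sub>m p $$ (i, j)"
        using arg_cong[OF fixed[of "unit_vec p j"], of "\<lambda>x. x $ i"] M by simp
    qed simp_all
    then show False using M_ne_one by simp
  qed
  then obtain u0 where "u0 \<in> V" "M *\<^sub>v u0 - u0 \<noteq> 0\<^sub>v p" by blast
  then obtain d where d: "d \<noteq> 0" "d \<cdot>\<^sub>v unit_vec p 0 \<in> {M *\<^sub>v u - u | u. u \<in> V}"
    using J_diff_invariant_multiple_first[of "{M *\<^sub>v u - u | u. u \<in> V}" "M *\<^sub>v u0 - u0"] J_diff_image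
    by (smt (verit, ccfv_threshold) M_vec_carrier mem_Collect_eq minus_carrier_vec subsetI)
  \<comment> \<open>\<open>y\<close> lies in the image of \<open>M - 1\<close> and, as a multiple of
    the fixed vector found above, also in its kernel.\<close>
  define y where "y = d \<cdot>\<^sub>v (unit_vec p 0 :: 'p mod_ring vec)"
  have y: "y \<in> V" by (simp add: y_def)
  have "y = (d / c) \<cdot>\<^sub>v (c \<cdot>\<^sub>v unit_vec p 0)" using c by (simp add: y_def smult_smult_assoc)
  then have My: "M *\<^sub>v y = y"
    using c M by (simp only: mult_mat_vec[of M p p] smult_carrier_vec unit_vec_carrier mem_Collect_eq)
  from d obtain u where u: "u \<in> V" "y = M *\<^sub>v u - u" by (auto simp: y_def)
  have Mu: "M *\<^sub>v u = u + y"
    using u by (intro eq_vecI) (simp_all del: index_mult_mat_vec)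
  \<comment> \<open>On \<open>u\<close> and \<open>y\<close> the matrix \<open>M\<close> acts
    unipotently; \<open>n = q\<close> yields \<open>q y = 0\<close>, impossible as \<open>p\<close>
    does not divide \<open>q\<close>.\<close>
  have "M ^\<^sub>m n *\<^sub>v u = u + of_nat n \<cdot>\<^sub>v y" for n
  proof (induction n)
    case 0
    show ?case using u y by (intro eq_vecI) simp_all
  next
    case (Suc n)
    have "M ^\<^sub>m Suc n *\<^sub>v u = M ^\<^sub>m n *\<^sub>v (u + y)"
      using u M by (simp add: assoc_mult_mat_vec[of _ p p _ p] Mu)
    also have "\<dots> = M ^\<^sub>m n *\<^sub>v u + y"
      using u(1) y pow_mat_fixed[OF M y My] by (simp add: mult_add_distrib_mat_vec[of _ p p])
    also have "\<dots> = u + of_nat (Suc n) \<cdot>\<^sub>v y"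
      using u(1) y unfolding Suc by (intro eq_vecI) (simp_all add: algebra_simps)
    finally show ?case .
  qed
  from this[of q] have "u = u + of_nat q \<cdot>\<^sub>v y"
    using u(1) M_pow_q by simp
  then have "u $ 0 = (u + of_nat q \<cdot>\<^sub>v y) $ 0" by simp
  then have "of_nat q * d = 0"
    using u(1) y two_le_p by (simp add: y_def)
  then have "(of_nat q :: 'p mod_ring) = 0" using d by simp
  then have "p dvd q" by (simp add: of_nat_eq_0_iff_char_dvd char_p card_p)
  then show False using primes_dvd_imp_eq[OF prime_p prime_q] p_ne_q by simp
qed

section \<open>Comparison with the opposite brace\<close>

lemma translation_pow:
  assumes "v \<in> V"
  shows "block (1\<^sub>m p) v ^\<^sub>m n = block (1\<^sub>m p) (of_nat n \<cdot>\<^sub>v v)"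
proof (induction n)
  case 0
  have "0 \<cdot>\<^sub>v v = 0\<^sub>v p" using assms by (intro eq_vecI) auto
  then show ?case using block_carrier_mat[of "1\<^sub>m p" p v] assms by (simp add: block_one)
next
  case (Suc n)
  have "v + of_nat n \<cdot>\<^sub>v v = of_nat (Suc n) \<cdot>\<^sub>v v"
    using assms by (intro eq_vecI) (auto simp: algebra_simps)
  then show ?case using Suc assms by (simp add: block_mult[of _ p])
qed

lemma block_M_pow_pow:
  assumes "v \<in> V"
  shows "\<exists>u\<in>V. block (M ^\<^sub>m k) v ^\<^sub>m n = block (M ^\<^sub>m (k * n)) u"
proof (induction n)
  case 0
  show ?case using M block_carrier_mat[of "M ^\<^sub>m k" p v] assms
    by (intro bexI[of _ "0\<^sub>v p"]) (simp_all add: block_one)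
next
  case (Suc n)
  then obtain u where "u \<in> V" "block (M ^\<^sub>m k) v ^\<^sub>m n = block (M ^\<^sub>m (k * n)) u" by blast
  then show ?case using assms
    by (intro bexI[of _ "M ^\<^sub>m (k * n) *\<^sub>v v + u"]) (simp_all add: block_M_pow_mult add.commute)
qed

text \<open>The linear part gives \<open>q dvd k * p\<close>, hence \<open>q dvd k\<close>. The
  identity is included, with \<open>v = 0\<close>.\<close>

lemma element_of_order_p:
  assumes R: "R \<in> carrier N" and Rp: "R ^\<^sub>m p = 1\<^sub>m (p + 1)"
  obtains v where "v \<in> V" "R = block (1\<^sub>m p) v"
proof -
  from R obtain k v where kv: "R = block (M ^\<^sub>m k) v" "v \<in> V" by (rule N_cases)
  obtain u where u: "u \<in> V" "R ^\<^sub>m p = block (M ^\<^sub>m (k * p)) u"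
    using block_M_pow_pow[OF kv(2)] kv(1) by blast
  then have "block (M ^\<^sub>m (k * p)) u = block (1\<^sub>m p) (0\<^sub>v p)"
    using Rp by (simp add: block_one)
  then have "M ^\<^sub>m (k * p) = 1\<^sub>m p"
    using u by (simp add: block_eq_iff[of _ p])
  then have "q dvd k * p" by (rule M_pow_eq_oneD)
  then have "q dvd k"
    using prime_dvd_mult_nat[OF prime_q] primes_dvd_imp_eq[OF prime_q prime_p] p_ne_q by blast
  then have "R = block (1\<^sub>m p) v" using kv by (simp add: M_pow_dvd)
  then show ?thesis using that kv by blast
qed

text \<open>An element of \<open>N\<close> is in the kernel of the \<open>\<lambda>\<close>-map of the brace if it satisfies
  \<open>a \<circ> b = a \<cdot> b\<close>, and in that of the opposite brace if it satisfies \<open>a \<circ> b = b \<cdot> a\<close>.\<close>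

lemma translation_in_kernel:
  assumes v: "v \<in> V" and ker: "\<And>T. T \<in> carrier N \<Longrightarrow> block (1\<^sub>m p) v \<otimes>\<^bsub>C\<^esub> T = block (1\<^sub>m p) v * T"
  shows "v = 0\<^sub>v p"
proof -
  define T where "T = block M (0\<^sub>v p)"
  have M1: "M ^\<^sub>m 1 = M" by (simp add: One_nat_def)
  have T: "T \<in> carrier N" using block_in_N[of "0\<^sub>v p" 1] by (simp add: T_def M1)
  have v0: "block (1\<^sub>m p) v \<in> carrier N" using block_in_N[OF v, of 0] by simp
  define k where "k = p ^ J_exp (- v)"
  have "snd (element_over G (block (1\<^sub>m p) v)) T = conj_by p q M (S (- v)) (block (M ^\<^sub>m 1) (0\<^sub>v p))"
    using v by (simp add: element_over_translation E_def T_def M1)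
  also have "\<dots> = block (M ^\<^sub>m k) (J_of (- v) *\<^sub>v 0\<^sub>v p + - v - M ^\<^sub>m k *\<^sub>v (- v))"
    using v by (subst conj_by_S) (simp_all add: k_def)
  also have "J_of (- v) *\<^sub>v 0\<^sub>v p + - v - M ^\<^sub>m k *\<^sub>v (- v) = M ^\<^sub>m k *\<^sub>v v - v"
  proof -
    have "J_of (- v) *\<^sub>v 0\<^sub>v p = 0\<^sub>v p"
      using carrier_matD[OF J_of_carrier] by (intro eq_vecI) auto
    then show ?thesis using v
      by (intro eq_vecI) (simp_all add: mult_mat_vec_uminus[of _ p p] del: index_mult_mat_vec)
  qed
  finally have 1: "snd (element_over G (block (1\<^sub>m p) v)) T = block (M ^\<^sub>m k) (M ^\<^sub>m k *\<^sub>v v - v)" .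
  have "block (M ^\<^sub>m k) (M ^\<^sub>m k *\<^sub>v v - v + v) = block (1\<^sub>m p) v \<otimes>\<^bsub>C\<^esub> T"
    using v by (simp add: circ_mult[OF v0 T] 1 block_mult[of _ p])
  also have "\<dots> = block M (0\<^sub>v p + v)"
    using v M unfolding ker[OF T] by (simp add: T_def block_mult[of _ p])
  finally have eq: "block (M ^\<^sub>m k) (M ^\<^sub>m k *\<^sub>v v - v + v) = block M (0\<^sub>v p + v)" .
  \<comment> \<open>Linear parts give \<open>M^k = M\<close>, translation parts give
    \<open>M^k v = v\<close>.\<close>
  have "M ^\<^sub>m k = M \<and> M ^\<^sub>m k *\<^sub>v v - v + v = 0\<^sub>v p + v"
    using v by (intro block_eq_iff[THEN iffD1, OF M_pow M _ _ eq]) simp_all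
  moreover have "M ^\<^sub>m k *\<^sub>v v - v + v = M ^\<^sub>m k *\<^sub>v v"
    using v by (intro eq_vecI) (simp_all del: index_mult_mat_vec)
  ultimately have "M *\<^sub>v v = v" using v(1) by (metis left_zero_vec)
  then show ?thesis using M_fixed_eq_zero v by blast
qed

theorem not_isomorphic_op:
  "\<not> skew_brace_isomorphic (skew_brace_of N G) (op_skew_brace (skew_brace_of N G))"
proof
  assume "skew_brace_isomorphic (skew_brace_of N G) (op_skew_brace (skew_brace_of N G))"
  then obtain f where "f \<in> iso N (op_group N)" and "f \<in> iso C C"
    by (auto simp: skew_brace_isomorphic_def op_skew_brace_def skew_brace_of_def)
  then have bij: "bij_betw f (carrier N) (carrier N)"
    and dot: "\<And>R T. R \<in> carrier N \<Longrightarrow> T \<in> carrier N \<Longrightarrow> f (R * T) = f T * f R"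
    and circ: "\<And>R T. R \<in> carrier N \<Longrightarrow> T \<in> carrier N \<Longrightarrow> f (R \<otimes>\<^bsub>C\<^esub> T) = f R \<otimes>\<^bsub>C\<^esub> f T"
    by (auto simp: iso_def hom_def carrier_C N_simps)
  interpret N: group N by (rule group_N)
  have f_closed: "f R \<in> carrier N" if "R \<in> carrier N" for R
    using bij that by (auto simp: bij_betw_def)
  \<comment> \<open>Index 0 is not the last one because \<open>p \<ge> 2\<close>, so
    \<open>circ_translation\<close> applies.\<close>
  define c where "c = block (1\<^sub>m p) (unit_vec p 0 :: 'p mod_ring vec)"
  have c: "c \<in> carrier N" using block_in_N[of "unit_vec p 0" 0] by (simp add: c_def)
  have one: "1\<^sub>m (p + 1) \<in> carrier N" using N.one_closed by (simp add: N_simps)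
  have f_one: "f (1\<^sub>m (p + 1)) = 1\<^sub>m (p + 1)"
    using N.r_cancel_one'[OF f_closed[OF one] f_closed[OF one]] dot[OF one one] by (simp add: N_simps)
  \<comment> \<open>\<open>f\<close> reverses products, but powers of a single element
    commute.\<close>
  have f_pow: "c ^\<^sub>m n \<in> carrier N \<and> f (c ^\<^sub>m n) = f c ^\<^sub>m n" for n
  proof (induction n)
    case 0
    then show ?case
      using N_carrier_mat[OF c] N_carrier_mat[OF f_closed[OF c]] one f_one by simp
  next
    case (Suc n)
    have "c ^\<^sub>m n * c \<in> carrier N" using Suc c N.m_closed[of "c ^\<^sub>m n" c] by (simp add: N_simps)
    moreover have "f c * f c ^\<^sub>m n = f c ^\<^sub>m n * f c"
      using pow_mat_add[OF N_carrier_mat[OF f_closed[OF c]], of 1 n] N_carrier_mat[OF f_closed[OF c]]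
      by (simp add: One_nat_def)
    then have "f (c ^\<^sub>m n * c) = f c ^\<^sub>m Suc n"
      using Suc c by (simp add: dot)
    ultimately show ?case by simp
  qed
  have "0 \<cdot>\<^sub>v unit_vec p 0 = (0\<^sub>v p :: 'p mod_ring vec)" by (intro eq_vecI) simp_all
  then have "c ^\<^sub>m p = 1\<^sub>m (p + 1)"
    using of_nat_CHAR[where 'a = "'p mod_ring"] by (simp add: c_def translation_pow card_p block_one)
  then have "f c ^\<^sub>m p = 1\<^sub>m (p + 1)"
    using f_pow[of p] f_one by simp
  then obtain v where v: "v \<in> V" "f c = block (1\<^sub>m p) v"
    using element_of_order_p f_closed[OF c] by blast
  have "v = 0\<^sub>v p"
  proof (rule translation_in_kernel[OF v(1)])
    fix T assume "T \<in> carrier N"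
    then obtain R where R: "R \<in> carrier N" "T = f R" using bij by (auto simp: bij_betw_def)
    have "c \<otimes>\<^bsub>C\<^esub> R = R * c"
      unfolding c_def using two_le_p R by (intro circ_translation) simp_all
    \<comment> \<open>Applying \<open>f\<close> to \<open>c \<circ> R = R * c\<close> reverses the
      right-hand side to \<open>f c * f R\<close>.\<close>
    then show "block (1\<^sub>m p) v \<otimes>\<^bsub>C\<^esub> T = block (1\<^sub>m p) v * T"
      using circ[OF c R(1)] dot[OF R(1) c] R v by simp
  qed
  then have "f c = f (1\<^sub>m (p + 1))" using v f_one by (simp add: block_one)
  then have "c = 1\<^sub>m (p + 1)"
    using bij c one by (auto simp: bij_betw_def dest: inj_onD)
  then have "unit_vec p 0 = (0\<^sub>v p :: 'p mod_ring vec)"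
    unfolding c_def block_one[symmetric] by (subst (asm) block_eq_iff[of _ p]) simp_all
  then have "unit_vec p 0 $ 0 = (0\<^sub>v p $ 0 :: 'p mod_ring)" by simp
  then show False using two_le_p by simp
qed

end

text \<open>The proof translates the group-theoretic hypotheses into those of
  \<open>brace_data\<close>.\<close>

theorem theorem4p4:
  fixes p q :: nat
    and M :: "'p :: prime_card mod_ring mat"
    and B :: "'p mod_ring mat skew_brace"
  assumes "Factorial_Ring.prime p" and "Factorial_Ring.prime q"
    and "CARD('p) = p"
    and "q dvd (p ^ p - 1) div (p - 1)"
    and "M \<in> carrier (GL p)"
    and "group.ord (GL p) M = q"
    and "jordan_block p 1 \<otimes>\<^bsub>GL p\<^esub> M \<otimes>\<^bsub>GL p\<^esub> inv\<^bsub>GL p\<^esub> (jordan_block p 1) = M ^\<^sub>m p"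
    and "B = skew_brace_of (N_group p q M) (G_subgroup p q M)"
  shows "\<not> skew_brace_isomorphic B (op_skew_brace B)"
proof -
  interpret GL: group "GL p :: 'p mod_ring mat monoid" by (rule group_GL)
  let ?J = "jordan_block p 1 :: 'p mod_ring mat"
  have p: "2 \<le> p" using assms(1) by (rule prime_ge_2_nat)
  have "?J ^\<^sub>m p = 1\<^sub>m p"
    using jordan_block_one_pow_prime[where 'a = "'p mod_ring"] assms(1,3) by simp
  moreover have "?J ^\<^sub>m p = ?J * ?J ^\<^sub>m (p - 1)" "?J ^\<^sub>m p = ?J ^\<^sub>m (p - 1) * ?J"
    using p pow_mat_add[of ?J p 1 "p - 1"] pow_mat_add[of ?J p "p - 1" 1] by simp_all
  ultimately have J: "?J \<in> carrier (GL p)"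
    by (intro GL_memI[where B = "?J ^\<^sub>m (p - 1)"]) simp_all
  have "M ^\<^sub>m p \<in> carrier (GL p)"
    using GL.nat_pow_closed[OF assms(5)] GL_pow[OF assms(5)] by metis
  then have "?J * M = M ^\<^sub>m p * ?J"
    using assms(7) GL.inv_solve_right[of "M ^\<^sub>m p" "?J \<otimes>\<^bsub>GL p\<^esub> M" ?J]
      GL.m_closed[OF J assms(5)] J assms(5)
    by (simp add: GL_simps)
  moreover have "M ^\<^sub>m q = 1\<^sub>m p"
    using GL.pow_ord_eq_1[OF assms(5)] GL_pow[OF assms(5)] assms(6) by (simp add: GL_simps)
  moreover have "M \<noteq> 1\<^sub>m p"
    using GL.ord_eq_1[OF assms(5)] assms(2,6) by (auto simp: GL_simps)
  \<comment> \<open>The quotient divides \<open>p^p - 1\<close>, which is prime to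
    \<open>p\<close>.\<close>
  moreover have "p \<noteq> q"
  proof
    assume "p = q"
    \<comment> \<open>This shows that the truncating \<open>div\<close> is exact here.\<close>
    have "[p = 1] (mod (p - 1))" using p by (simp add: cong_altdef_nat)
    then have "[p ^ p = 1 ^ p] (mod (p - 1))" by (rule cong_pow)
    then have "p - 1 dvd p ^ p - 1" using p by (simp add: cong_altdef_nat)
    then have "(p ^ p - 1) div (p - 1) dvd p ^ p - 1" by (metis dvd_triv_left dvd_div_mult_self)
    then have "p dvd p ^ p - 1" using assms(4) \<open>p = q\<close> dvd_trans by blast
    moreover have "p dvd p ^ p" using p by simp
    ultimately have "p dvd p ^ p - (p ^ p - 1)" by (rule dvd_diff_nat[rotated])
    moreover have "p ^ p - (p ^ p - 1) = 1" using p by simp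
    ultimately show False using p by simp
  qed
  ultimately interpret brace_data p q M
    using assms GL_carrier_mat[OF assms(5)] by unfold_locales
  show ?thesis using not_isomorphic_op assms(8) by simp
qed

end
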